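(* There exists a constant $C>0$, independent of the domain, such that the following holds. Let $\Omega\subset\mathbb{R}^2$ be a bounded convex domain, let $\lambda_1$ be the first (smallest) Dirichlet eigenvalue of $-\Delta$ on $\Omega$, and let $u_1$ be the corresponding $L^2(\Omega)$-normalized eigenfunction. Then $$\|\partial_n u_1\|_{L^\infty(\partial\Omega)}\le C\,\lambda_1 .$$
   Context: A Dirichlet eigenpair $(\lambda,u)$ of $\Omega$ is a nontrivial solution of $-\Delta u=\lambda u$ in $\Omega$, $u=0$ on $\partial\Omega$, where $\Delta$ is the two-dimensional Laplacian. A domain is a nonempty connected open set. $L^2$-normalized means $\int_\Omega u_1^2\,dx=1$. $\partial_n u_1$ denotes the normal derivative of $u_1$ on the boundary $\partial\Omega$ (the choice of inward or outward unit normal is irrelevant for the norm). *)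

theory Defs
  imports "HOL-Analysis.Analysis" "HOL-Probability.Essential_Supremum"
begin

section \<open>One-dimensional Hausdorff measure\<close>

definition hausdorff1_pre :: "real \<Rightarrow> 'a::metric_space set \<Rightarrow> ennreal" where
  "hausdorff1_pre \<delta> S =
     (INF A \<in> {A :: nat \<Rightarrow> 'a set. S \<subseteq> (\<Union>i. A i) \<and> (\<forall>i. bounded (A i) \<and> diameter (A i) \<le> \<delta>)}.
        \<Sum>i. ennreal (diameter (A i)))"

definition hausdorff1_outer :: "'a::metric_space set \<Rightarrow> ennreal" where
  "hausdorff1_outer S = (SUP \<delta>\<in>{0<..}. hausdorff1_pre \<delta> S)"

text \<open>On a rectifiable curve in the plane this is arc length; the sigma-algebra consists of the
  Caratheodory-measurable sets, and contains all Borel sets (lemma \<open>sets_hausdorff1_borel\<close>).\<close>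

definition hausdorff1 :: "'a::metric_space measure" where
  "hausdorff1 = measure_of UNIV (lambda_system UNIV (Pow UNIV) hausdorff1_outer) hausdorff1_outer"

lemma hausdorff1_pre_le:
  assumes "S \<subseteq> (\<Union>i. A i)" "\<And>i. bounded (A i)" "\<And>i. diameter (A i) \<le> \<delta>"
  shows "hausdorff1_pre \<delta> S \<le> (\<Sum>i. ennreal (diameter (A (i::nat))))"
  unfolding hausdorff1_pre_def by (rule INF_lower) (use assms in auto)

lemma hausdorff1_pre_mono: "S \<subseteq> T \<Longrightarrow> hausdorff1_pre \<delta> S \<le> hausdorff1_pre \<delta> T"
  unfolding hausdorff1_pre_def by (intro INF_superset_mono) auto

lemma hausdorff1_pre_antimono: "\<delta> \<le> \<delta>' \<Longrightarrow> hausdorff1_pre \<delta>' S \<le> hausdorff1_pre \<delta> S"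
  unfolding hausdorff1_pre_def by (intro INF_superset_mono) (auto intro: order_trans)

lemma hausdorff1_pre_le_outer: "0 < \<delta> \<Longrightarrow> hausdorff1_pre \<delta> S \<le> hausdorff1_outer S"
  unfolding hausdorff1_outer_def by (rule SUP_upper) auto

lemma hausdorff1_outer_mono: "S \<subseteq> T \<Longrightarrow> hausdorff1_outer S \<le> hausdorff1_outer T"
  unfolding hausdorff1_outer_def by (intro SUP_mono) (use hausdorff1_pre_mono in blast)

lemma hausdorff1_outer_empty [simp]: "hausdorff1_outer ({} :: 'a::metric_space set) = 0"
proof -
  have "hausdorff1_pre \<delta> ({} :: 'a set) = 0" if "\<delta> > 0" for \<delta>
    using hausdorff1_pre_le[of "{} :: 'a set" "\<lambda>_. {}" \<delta>] that by auto
  then have "(SUP \<delta>\<in>{0<..}. hausdorff1_pre \<delta> ({} :: 'a set)) = (SUP \<delta>\<in>{0::real<..}. 0)"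
    by (intro SUP_cong) auto
  then show ?thesis
    by (simp add: hausdorff1_outer_def)
qed

lemma hausdorff1_outer_UN: "hausdorff1_outer (\<Union>i. A i) \<le> (\<Sum>i::nat. hausdorff1_outer (A i))"
proof -
  have "hausdorff1_pre \<delta> (\<Union>i. A i) \<le> (\<Sum>i. hausdorff1_outer (A i))" if \<delta>: "\<delta> > 0" for \<delta>
  proof (rule ennreal_le_epsilon)
    fix e :: real
    assume e: "0 < e" and fin: "(\<Sum>i. hausdorff1_outer (A i)) < top"
    have "\<exists>B. A n \<subseteq> (\<Union>i. B i) \<and> (\<forall>i. bounded (B i) \<and> diameter (B i) \<le> \<delta>) \<and>
            (\<Sum>i. ennreal (diameter (B (i::nat)))) < hausdorff1_outer (A n) + ennreal (e * (1/2)^Suc n)" for n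
    proof -
      have "hausdorff1_outer (A n) < top"
        using fin by (auto simp add: less_top dest!: ennreal_suminf_lessD)
      then have "hausdorff1_pre \<delta> (A n) < hausdorff1_outer (A n) + ennreal (e * (1/2)^Suc n)"
        using e by (intro le_less_trans[OF hausdorff1_pre_le_outer[OF \<delta>]])
          (auto simp: ennreal_add_left_cancel_less[of "hausdorff1_outer (A n)" 0, simplified])
      then show ?thesis
        unfolding hausdorff1_pre_def INF_less_iff by auto
    qed
    then obtain B where B: "\<And>n. A n \<subseteq> (\<Union>i. B n i)" "\<And>n i. bounded (B n i)"
        "\<And>n i. diameter (B n i) \<le> \<delta>"
        "\<And>n. (\<Sum>i. ennreal (diameter (B n (i::nat)))) \<le> hausdorff1_outer (A n) + ennreal (e * (1/2)^Suc n)"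
      by (metis order_less_imp_le)
    define C where "C = case_prod B o prod_decode"
    have "(\<Union>i. A i) \<subseteq> (\<Union>i. C i)"
      using B(1) by (auto simp add: C_def subset_eq) (metis prod.case prod_encode_inverse)
    then have "hausdorff1_pre \<delta> (\<Union>i. A i) \<le> (\<Sum>i. ennreal (diameter (C i)))"
      by (rule hausdorff1_pre_le) (auto simp: C_def split_def B)
    also have "\<dots> = (\<Sum>n. \<Sum>i. ennreal (diameter (B n i)))"
      using suminf_ennreal_2dimen[of "\<lambda>n. \<Sum>i. ennreal (diameter (B n i))"
          "\<lambda>p. ennreal (diameter (case_prod B p))"]
      by (simp add: C_def)
    also have "\<dots> \<le> (\<Sum>n. hausdorff1_outer (A n) + ennreal (e * (1/2) ^ Suc n))"
      by (intro suminf_le B(4)) auto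
    also have "\<dots> = (\<Sum>n. hausdorff1_outer (A n)) + (\<Sum>n. ennreal e * ennreal ((1/2) ^ Suc n))"
      using e by (subst suminf_add[symmetric])
                 (auto simp del: ennreal_suminf_cmult simp add: ennreal_mult[symmetric])
    also have "\<dots> = (\<Sum>n. hausdorff1_outer (A n)) + ennreal e"
      unfolding ennreal_suminf_cmult
      by (subst suminf_ennreal_eq[OF zero_le_power power_half_series]) auto
    finally show "hausdorff1_pre \<delta> (\<Union>i. A i) \<le> (\<Sum>n. hausdorff1_outer (A n)) + ennreal e" .
  qed
  then show ?thesis
    by (auto simp: hausdorff1_outer_def intro!: SUP_least)
qed

lemma outer_measure_space_hausdorff1: "outer_measure_space (Pow UNIV) hausdorff1_outer"
  unfolding outer_measure_space_def positive_def increasing_def countably_subadditive_def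
  using hausdorff1_outer_mono hausdorff1_outer_UN by auto

lemma measure_space_hausdorff1:
  "measure_space UNIV (lambda_system UNIV (Pow UNIV) hausdorff1_outer) hausdorff1_outer"
  by (rule sigma_algebra.caratheodory_lemma[OF sigma_algebra_Pow outer_measure_space_hausdorff1])

lemma space_hausdorff1 [simp]: "space hausdorff1 = UNIV"
  by (simp add: hausdorff1_def space_measure_of_conv)

lemma sets_hausdorff1: "sets hausdorff1 = lambda_system UNIV (Pow UNIV) hausdorff1_outer"
  using measure_space_hausdorff1
  unfolding hausdorff1_def measure_space_def by (intro sigma_algebra.sets_measure_of_eq) auto

lemma emeasure_hausdorff1: "S \<in> sets hausdorff1 \<Longrightarrow> emeasure hausdorff1 S = hausdorff1_outer S"
  using measure_space_hausdorff1 unfolding sets_hausdorff1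
  unfolding hausdorff1_def measure_space_def by (intro emeasure_measure_of_sigma) auto

subsection \<open>Borel sets are Caratheodory-measurable\<close>

lemma hausdorff1_outer_Un: "hausdorff1_outer (A \<union> B) \<le> hausdorff1_outer A + hausdorff1_outer B"
proof -
  define F where "F i = (if i = 0 then A else if i = 1 then B else {})" for i :: nat
  have "A \<union> B = (\<Union>i. F i)"
    by (auto simp: F_def split: if_splits)
  then have "hausdorff1_outer (A \<union> B) \<le> (\<Sum>i. hausdorff1_outer (F i))"
    using hausdorff1_outer_UN[of F] by simp
  also have "\<dots> = (\<Sum>i\<in>{0, 1}. hausdorff1_outer (F i))"
    by (rule suminf_finite) (auto simp: F_def)
  finally show ?thesis
    by (simp add: F_def)
qed

lemma hausdorff1_outer_separated:
  fixes P Q :: "'a::metric_space set"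
  assumes d: "d > 0" "\<And>x y. x \<in> P \<Longrightarrow> y \<in> Q \<Longrightarrow> d \<le> dist x y"
  shows "hausdorff1_outer P + hausdorff1_outer Q \<le> hausdorff1_outer (P \<union> Q)"
proof -
  have small: "hausdorff1_pre \<delta> P + hausdorff1_pre \<delta> Q \<le> hausdorff1_pre \<delta> (P \<union> Q)"
    if \<delta>: "0 < \<delta>" "\<delta> < d" for \<delta>
    unfolding hausdorff1_pre_def[of \<delta> "P \<union> Q"]
  proof (rule INF_greatest)
    fix A :: "nat \<Rightarrow> 'a set"
    assume "A \<in> {A. P \<union> Q \<subseteq> (\<Union>i. A i) \<and> (\<forall>i. bounded (A i) \<and> diameter (A i) \<le> \<delta>)}"
    then have A: "P \<union> Q \<subseteq> (\<Union>i. A i)" "\<And>i. bounded (A i)" "\<And>i. diameter (A i) \<le> \<delta>"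
      by auto
    define B where "B i = (if A i \<inter> P \<noteq> {} then A i else {})" for i
    define C where "C i = (if A i \<inter> P \<noteq> {} then {} else A i)" for i
    have sep: "A i \<inter> Q = {}" if "A i \<inter> P \<noteq> {}" for i
    proof (rule ccontr)
      assume "A i \<inter> Q \<noteq> {}"
      with that obtain x y where xy: "x \<in> A i" "y \<in> A i" "x \<in> P" "y \<in> Q" by blast
      then have "d \<le> diameter (A i)"
        using d(2) diameter_bounded_bound[OF A(2)] order_trans by metis
      with A(3)[of i] \<delta> show False by linarith
    qed
    have "hausdorff1_pre \<delta> P \<le> (\<Sum>i. ennreal (diameter (B i)))"
    proof (rule hausdorff1_pre_le)
      show "P \<subseteq> (\<Union>i. B i)"
        using A(1) unfolding B_def by fastforce
    qed (use A \<delta> in \<open>auto simp: B_def\<close>)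
    moreover have "hausdorff1_pre \<delta> Q \<le> (\<Sum>i. ennreal (diameter (C i)))"
    proof (rule hausdorff1_pre_le)
      show "Q \<subseteq> (\<Union>i. C i)"
      proof
        fix x assume x: "x \<in> Q"
        with A(1) obtain i where i: "x \<in> A i" by blast
        with x sep[of i] have "A i \<inter> P = {}" by blast
        with i have "x \<in> C i" by (simp add: C_def)
        then show "x \<in> (\<Union>i. C i)" by blast
      qed
    qed (use A \<delta> in \<open>auto simp: C_def\<close>)
    moreover have "(\<Sum>i. ennreal (diameter (B i))) + (\<Sum>i. ennreal (diameter (C i)))
        = (\<Sum>i. ennreal (diameter (A i)))"
      by (subst suminf_add) (auto simp: B_def C_def intro!: suminf_cong)
    ultimately show "hausdorff1_pre \<delta> P + hausdorff1_pre \<delta> Q \<le> (\<Sum>i. ennreal (diameter (A i)))"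
      by (metis add_mono)
  qed
  have dir: "hausdorff1_pre i P + hausdorff1_pre j Q \<le> hausdorff1_outer (P \<union> Q)"
    if "0 < i" "0 < j" for i j
  proof -
    define k where "k = min (min i j) (d / 2)"
    have k: "0 < k" "k < d" "k \<le> i" "k \<le> j"
      using that d by (auto simp: k_def)
    have "hausdorff1_pre i P + hausdorff1_pre j Q \<le> hausdorff1_pre k P + hausdorff1_pre k Q"
      using k by (intro add_mono hausdorff1_pre_antimono)
    also have "\<dots> \<le> hausdorff1_outer (P \<union> Q)"
      using small hausdorff1_pre_le_outer k order_trans by blast
    finally show ?thesis .
  qed
  have "hausdorff1_outer P + hausdorff1_outer Q
      = (SUP i\<in>{0<..}. hausdorff1_pre i P + hausdorff1_outer Q)"
    unfolding hausdorff1_outer_def[of P] by (rule ennreal_SUP_add_left[symmetric]) auto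
  also have "\<dots> = (SUP i\<in>{0<..}. SUP j\<in>{0<..}. hausdorff1_pre i P + hausdorff1_pre j Q)"
    unfolding hausdorff1_outer_def[of Q]
    by (intro SUP_cong refl ennreal_SUP_add_right) auto
  also have "\<dots> \<le> hausdorff1_outer (P \<union> Q)"
    by (intro SUP_least dir) auto
  finally show ?thesis .
qed

lemma closed_in_sets_hausdorff1:
  fixes S :: "'a::metric_space set"
  assumes S: "closed S"
  shows "S \<in> sets hausdorff1"
proof -
  have main: "hausdorff1_outer (A \<inter> S) + hausdorff1_outer (A - S) \<le> hausdorff1_outer A"
    if ne: "S \<noteq> {}" and fin: "hausdorff1_outer A < top" for A
  proof -
    define E where "E n = {x \<in> A. 1 / real (Suc n) \<le> infdist x S}" for n
    define R where "R n = E (Suc n) - E n" for n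
    have E_mono: "E m \<subseteq> E n" if "m \<le> n" for m n
    proof -
      have "1 / real (Suc n) \<le> 1 / real (Suc m)"
        using that by (simp add: frac_le)
      then show ?thesis by (auto simp: E_def)
    qed
    have E_Un: "A - S = (\<Union>n. E n)"
    proof
      show "A - S \<subseteq> (\<Union>n. E n)"
      proof
        fix x assume x: "x \<in> A - S"
        then have "0 < infdist x S"
          using S ne by (simp add: infdist_pos_not_in_closed)
        then obtain n where "inverse (real (Suc n)) < infdist x S"
          using reals_Archimedean by blast
        then show "x \<in> (\<Union>n. E n)"
          using x by (auto simp: E_def inverse_eq_divide intro!: exI[of _ n])
      qed
      show "(\<Union>n. E n) \<subseteq> A - S"
      proof
        fix x assume "x \<in> (\<Union>n. E n)"
        then obtain n where n: "x \<in> A" "1 / real (Suc n) \<le> infdist x S"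
          by (auto simp: E_def)
        have "x \<notin> S"
        proof
          assume "x \<in> S"
          with n have "1 / real (Suc n) \<le> 0" by simp
          then show False by simp
        qed
        with n show "x \<in> A - S" by simp
      qed
    qed
    have step: "hausdorff1_outer (R (Suc n)) + hausdorff1_outer (E n) \<le> hausdorff1_outer (E (Suc (Suc n)))" for n
    proof -
      define d where "d = 1 / real (Suc n) - 1 / real (Suc (Suc n))"
      have "d > 0"
        unfolding d_def diff_gt_0_iff_gt by (rule divide_strict_left_mono) auto
      moreover have "d \<le> dist x y" if "x \<in> R (Suc n)" "y \<in> E n" for x y
      proof -
        have "infdist y S \<le> infdist x S + dist y x"
          by (rule infdist_triangle)
        with that show ?thesis
          by (auto simp: R_def E_def d_def dist_commute)
      qed
      ultimately have "hausdorff1_outer (R (Suc n)) + hausdorff1_outer (E n)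
          \<le> hausdorff1_outer (R (Suc n) \<union> E n)"
        by (rule hausdorff1_outer_separated)
      also have "\<dots> \<le> hausdorff1_outer (E (Suc (Suc n)))"
        using E_mono[of n "Suc (Suc n)"] by (intro hausdorff1_outer_mono) (auto simp: R_def)
      finally show ?thesis .
    qed
    have part: "(\<Sum>k<N. hausdorff1_outer (R (2 * k + c + 1))) \<le> hausdorff1_outer (E (2 * N + c))" for N c
    proof (induction N)
      case (Suc N)
      have "(\<Sum>k<Suc N. hausdorff1_outer (R (2 * k + c + 1)))
          \<le> hausdorff1_outer (R (Suc (2 * N + c))) + hausdorff1_outer (E (2 * N + c))"
        using Suc.IH by (simp add: add.commute add_right_mono)
      also have "\<dots> \<le> hausdorff1_outer (E (2 * Suc N + c))"
        using step[of "2 * N + c"] by simp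
      finally show ?case .
    qed simp
    have EA: "hausdorff1_outer (E n) \<le> hausdorff1_outer A" for n
      by (intro hausdorff1_outer_mono) (auto simp: E_def)
    define f where "f k = hausdorff1_outer (R (Suc k))" for k
    have split: "(\<Sum>k<2 * N. f k) = (\<Sum>k<N. f (2 * k)) + (\<Sum>k<N. f (2 * k + 1))" for N
      by (induction N) (auto simp: ac_simps)
    have bound: "(\<Sum>k<N. f k) \<le> hausdorff1_outer A + hausdorff1_outer A" for N
    proof -
      have "(\<Sum>k<N. f k) \<le> (\<Sum>k<2 * N. f k)"
        by (intro sum_mono2) auto
      also have "\<dots> \<le> hausdorff1_outer A + hausdorff1_outer A"
        unfolding split
        using order_trans[OF part[where N=N and c=0] EA] order_trans[OF part[where N=N and c=1] EA]
        by (intro add_mono) (simp_all add: f_def)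
      finally show ?thesis .
    qed
    have "suminf f \<le> hausdorff1_outer A + hausdorff1_outer A"
      by (intro suminf_le_const[OF summableI] bound)
    also have "\<dots> < top"
      using fin by simp
    finally have f_fin: "suminf f < top" .
    show ?thesis
    proof (rule ennreal_le_epsilon)
      fix e :: real
      assume e: "0 < e"
      have "(\<lambda>n. \<Sum>k<n. f k) \<longlonglongrightarrow> suminf f"
        using summable_LIMSEQ[OF summableI] .
      then have "eventually (\<lambda>n. suminf f < (\<Sum>k<n. f k) + ennreal e) sequentially"
      proof -
        have "((\<lambda>n. (\<Sum>k<n. f k) + ennreal e) \<longlongrightarrow> suminf f + ennreal e) sequentially"
          by (intro tendsto_add summable_LIMSEQ[OF summableI] tendsto_const)
        moreover have "suminf f < suminf f + ennreal e"
          using f_fin e ennreal_add_left_cancel_less[of "suminf f" 0 "ennreal e"]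
          by (simp add: less_top)
        ultimately show ?thesis
          by (rule order_tendstoD(1))
      qed
      then obtain n where n: "suminf f < (\<Sum>k<n. f k) + ennreal e"
        by (auto simp: eventually_sequentially)
      have "suminf f = (\<Sum>k. f (k + n)) + (\<Sum>k<n. f k)"
        by (rule suminf_offset[OF summableI])
      moreover have "(\<Sum>k<n. f k) < top"
        by (rule le_less_trans[OF _ f_fin]) (intro sum_le_suminf summableI, auto)
      ultimately have tail: "(\<Sum>k. f (k + n)) \<le> ennreal e"
        using n ennreal_add_left_cancel_less[of "\<Sum>k<n. f k"]
        by (auto simp: add.commute)
      have cover: "A - S \<subseteq> E (Suc n) \<union> (\<Union>k. R (Suc (k + n)))"
      proof
        fix x assume "x \<in> A - S"
        then have ex: "\<exists>m. x \<in> E m" using E_Un by auto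
        define m where "m = (LEAST m. x \<in> E m)"
        have m: "x \<in> E m" unfolding m_def by (rule LeastI_ex[OF ex])
        show "x \<in> E (Suc n) \<union> (\<Union>k. R (Suc (k + n)))"
        proof (cases "m \<le> Suc n")
          case True
          then show ?thesis using m E_mono by blast
        next
          case False
          then have "m = Suc (Suc (m - Suc (Suc n) + n))" by simp
          moreover have "x \<notin> E (m - 1)"
            using False not_less_Least[of "m - 1" "\<lambda>m. x \<in> E m"] by (auto simp: m_def[symmetric])
          ultimately have "x \<in> R (Suc ((m - Suc (Suc n)) + n))"
            using m unfolding R_def by (metis DiffI diff_Suc_1)
          then show ?thesis by blast
        qed
      qed
      have "hausdorff1_outer (A - S) \<le> hausdorff1_outer (E (Suc n) \<union> (\<Union>k. R (Suc (k + n))))"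
        by (rule hausdorff1_outer_mono[OF cover])
      also have "\<dots> \<le> hausdorff1_outer (E (Suc n)) + hausdorff1_outer (\<Union>k. R (Suc (k + n)))"
        by (rule hausdorff1_outer_Un)
      also have "\<dots> \<le> hausdorff1_outer (E (Suc n)) + (\<Sum>k. f (k + n))"
        unfolding f_def by (intro add_left_mono hausdorff1_outer_UN)
      also have "\<dots> \<le> hausdorff1_outer (E (Suc n)) + ennreal e"
        by (intro add_left_mono tail)
      finally have "hausdorff1_outer (A \<inter> S) + hausdorff1_outer (A - S)
          \<le> hausdorff1_outer (A \<inter> S) + hausdorff1_outer (E (Suc n)) + ennreal e"
        by (simp add: add_left_mono add.assoc)
      also have "hausdorff1_outer (A \<inter> S) + hausdorff1_outer (E (Suc n))
          \<le> hausdorff1_outer (A \<inter> S \<union> E (Suc n))"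
      proof (rule hausdorff1_outer_separated)
        show "0 < 1 / real (Suc (Suc n))" by simp
        fix x y assume "x \<in> A \<inter> S" "y \<in> E (Suc n)"
        then show "1 / real (Suc (Suc n)) \<le> dist x y"
          using infdist_le[of x S y] by (auto simp: E_def dist_commute)
      qed
      also have "\<dots> \<le> hausdorff1_outer A"
        by (intro hausdorff1_outer_mono) (auto simp: E_def)
      finally show "hausdorff1_outer (A \<inter> S) + hausdorff1_outer (A - S) \<le> hausdorff1_outer A + ennreal e"
        by (simp add: add_right_mono)
    qed
  qed
  have "hausdorff1_outer (A \<inter> S) + hausdorff1_outer (A - S) = hausdorff1_outer A" for A
  proof (rule antisym)
    show "hausdorff1_outer (A \<inter> S) + hausdorff1_outer (A - S) \<le> hausdorff1_outer A"
    proof (cases "S \<noteq> {} \<and> hausdorff1_outer A < top")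
      case True
      then show ?thesis using main by blast
    next
      case False
      then show ?thesis by (auto simp: less_top[symmetric])
    qed
    show "hausdorff1_outer A \<le> hausdorff1_outer (A \<inter> S) + hausdorff1_outer (A - S)"
      using hausdorff1_outer_Un[of "A \<inter> S" "A - S"] by (simp add: Int_Diff_Un)
  qed
  then show ?thesis
    unfolding sets_hausdorff1 algebra.lambda_system_eq[OF algebra_Pow] by simp
qed

lemma sets_hausdorff1_borel:
  fixes S :: "'a::metric_space set"
  assumes "S \<in> sets borel"
  shows "S \<in> sets hausdorff1"
proof -
  have "Collect closed \<subseteq> sets (hausdorff1 :: 'a measure)"
    using closed_in_sets_hausdorff1 by blast
  then have "sigma_sets (space (hausdorff1 :: 'a measure)) (Collect closed) \<subseteq> sets hausdorff1"
    by (rule sets.sigma_sets_subset)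
  moreover have "sets (borel :: 'a measure) = sigma_sets UNIV (Collect closed)"
    unfolding borel_eq_closed by (rule sets_measure_of) simp
  ultimately show ?thesis
    using assms by auto
qed

section \<open>Classical Dirichlet eigenpairs\<close>

definition partial_deriv :: "'n \<Rightarrow> (real ^ 'n \<Rightarrow> real) \<Rightarrow> real ^ 'n::finite \<Rightarrow> real" where
  "partial_deriv i f x = frechet_derivative f (at x) (axis i 1)"

definition C2_on :: "(real ^ 'n::finite) set \<Rightarrow> (real ^ 'n \<Rightarrow> real) \<Rightarrow> bool" where
  "C2_on \<Omega> f \<longleftrightarrow> f differentiable_on \<Omega> \<and> (\<forall>i. partial_deriv i f differentiable_on \<Omega>) \<and>
     (\<forall>i j. continuous_on \<Omega> (partial_deriv i (partial_deriv j f)))"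

definition laplacian :: "(real ^ 'n::finite \<Rightarrow> real) \<Rightarrow> real ^ 'n \<Rightarrow> real" where
  "laplacian f x = (\<Sum>i\<in>UNIV. partial_deriv i (partial_deriv i f) x)"

text \<open>Solutions are taken in \<open>C\<^sup>2(\<Omega>) \<inter> C(closure \<Omega>)\<close>. On a bounded convex domain every boundary point is
  regular, so these are exactly the weak eigenfunctions in \<open>H\<^sup>1\<^sub>0(\<Omega>)\<close>. The values of \<open>u\<close> outside the
  closure of \<open>\<Omega>\<close> are irrelevant.\<close>

definition dirichlet_eigenpair :: "(real ^ 2) set \<Rightarrow> real \<Rightarrow> (real ^ 2 \<Rightarrow> real) \<Rightarrow> bool" where
  "dirichlet_eigenpair \<Omega> lam u \<longleftrightarrow>
     C2_on \<Omega> u \<and> continuous_on (closure \<Omega>) u \<and>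
     (\<forall>x\<in>\<Omega>. - laplacian u x = lam * u x) \<and> (\<forall>x\<in>frontier \<Omega>. u x = 0) \<and> (\<exists>x\<in>\<Omega>. u x \<noteq> 0)"

definition dirichlet_eigenvalue :: "(real ^ 2) set \<Rightarrow> real \<Rightarrow> bool" where
  "dirichlet_eigenvalue \<Omega> lam \<longleftrightarrow> (\<exists>u. dirichlet_eigenpair \<Omega> lam u)"

definition first_dirichlet_eigenvalue :: "(real ^ 2) set \<Rightarrow> real \<Rightarrow> bool" where
  "first_dirichlet_eigenvalue \<Omega> lam \<longleftrightarrow>
     dirichlet_eigenvalue \<Omega> lam \<and> (\<forall>\<mu>. dirichlet_eigenvalue \<Omega> \<mu> \<longrightarrow> lam \<le> \<mu>)"

definition L2_normalized :: "(real ^ 2) set \<Rightarrow> (real ^ 2 \<Rightarrow> real) \<Rightarrow> bool" where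
  "L2_normalized \<Omega> u \<longleftrightarrow> (LINT x:\<Omega>|lborel. (u x)\<^sup>2) = 1"

section \<open>Normal derivative on the boundary of a convex domain\<close>

definition outward_unit_normals :: "'a::euclidean_space set \<Rightarrow> 'a \<Rightarrow> 'a set" where
  "outward_unit_normals \<Omega> x = {\<nu>. norm \<nu> = 1 \<and> (\<forall>y\<in>\<Omega>. (y - x) \<bullet> \<nu> \<le> 0)}"

text \<open>The normal exists, i.e. the above set is a singleton, at all but countably many boundary
  points of a planar convex domain. The derivative at \<open>x\<close> in direction of the outward normal is
  the one-sided one from inside the domain.\<close>

definition has_normal_derivative ::
  "'a::euclidean_space set \<Rightarrow> ('a \<Rightarrow> real) \<Rightarrow> 'a \<Rightarrow> real \<Rightarrow> bool" where
  "has_normal_derivative \<Omega> u x D \<longleftrightarrow>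
     (\<exists>\<nu>. outward_unit_normals \<Omega> x = {\<nu>} \<and>
          ((\<lambda>t. u (x + t *\<^sub>R \<nu>)) has_real_derivative D) (at_left 0))"

definition normal_derivative :: "'a::euclidean_space set \<Rightarrow> ('a \<Rightarrow> real) \<Rightarrow> 'a \<Rightarrow> real" where
  "normal_derivative \<Omega> u x = (THE D. has_normal_derivative \<Omega> u x D)"

definition boundary_measure :: "'a::metric_space set \<Rightarrow> 'a measure" where
  "boundary_measure \<Omega> = restrict_space hausdorff1 (frontier \<Omega>)"

text \<open>This is infinite if \<open>f\<close> is not measurable.\<close>

definition Linfty_norm :: "'a measure \<Rightarrow> ('a \<Rightarrow> real) \<Rightarrow> ereal" where
  "Linfty_norm M f = esssup M (\<lambda>x. ereal \<bar>f x\<bar>)"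

lemma has_normal_derivative_unique:
  assumes "has_normal_derivative \<Omega> u x D" "has_normal_derivative \<Omega> u x D'"
  shows "D = D'"
proof -
  obtain \<nu> \<nu>' where N: "outward_unit_normals \<Omega> x = {\<nu>}" "outward_unit_normals \<Omega> x = {\<nu>'}"
    and D: "((\<lambda>t. u (x + t *\<^sub>R \<nu>)) has_real_derivative D) (at_left 0)"
    and D': "((\<lambda>t. u (x + t *\<^sub>R \<nu>')) has_real_derivative D') (at_left 0)"
    using assms unfolding has_normal_derivative_def by blast
  from N have "\<nu>' = \<nu>" by simp
  with D' have "((\<lambda>t. u (x + t *\<^sub>R \<nu>)) has_real_derivative D') (at_left 0)"
    by simp
  with D show ?thesis
    unfolding has_field_derivative_iff by (rule tendsto_unique[OF trivial_limit_at_left_real])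
qed

lemma normal_derivative_eq: "has_normal_derivative \<Omega> u x D \<Longrightarrow> normal_derivative \<Omega> u x = D"
  unfolding normal_derivative_def by (rule the_equality, assumption) (rule has_normal_derivative_unique)

end

theory Submission
  imports Defs
begin

text \<open>All estimates come from the maximum principle. Let \<open>M = max \<bar>u\<bar>\<close>. Comparison
  with a concave quadratic profile of the distance to a supporting line gives \<open>\<bar>u\<bar> \<le> L dist\<close> with
  \<open>L = 4 \<surd>\<lambda> M\<close>, and doubling of variables upgrades this to the Lipschitz constant \<open>L\<close> on all of the
  domain. Hence \<open>\<bar>u\<bar> \<ge> M/2\<close> on a disc of radius \<open>1/(8\<surd>\<lambda>)\<close>, so that normalization forces \<open>M \<le> 16 \<surd>\<lambda>\<close> and
  \<open>L \<le> 64 \<lambda>\<close>.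

  At a boundary point with a unique normal the boundary is flat to first order. There \<open>u\<close> is
  almost constant in tangential direction at small scales, and comparison in a wide flat box shows that
  \<open>max 0 (u/r)\<close> along the inner normal is almost monotone in \<open>r\<close>. It converges, and so does the
  same quantity for \<open>-u\<close>. All but countably many boundary points have a unique normal, because the
  normal cones of the others have disjoint nonempty interiors.\<close>

section \<open>The maximum principle\<close>

text \<open>A pointwise second derivative at 0 as a relation: only a first derivative near 0, itself
  differentiable at 0, is asked for. It thus applies to a function along a line that stays in the
  domain only for small \<open>t\<close>.\<close>

definition second_deriv0 :: "(real \<Rightarrow> real) \<Rightarrow> real \<Rightarrow> bool" where
  "second_deriv0 f a \<longleftrightarrow> (\<exists>f'. (\<forall>\<^sub>F t in nhds 0. (f has_real_derivative f' t) (at t)) \<and>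
     (f' has_real_derivative a) (at 0))"

lemma second_deriv0_add:
  assumes "second_deriv0 f a" "second_deriv0 g b"
  shows "second_deriv0 (\<lambda>t. f t + g t) (a + b)"
proof -
  obtain f' g' where d: "\<forall>\<^sub>F t in nhds 0. (f has_real_derivative f' t) (at t)"
      "\<forall>\<^sub>F t in nhds 0. (g has_real_derivative g' t) (at t)"
      "(f' has_real_derivative a) (at 0)" "(g' has_real_derivative b) (at 0)"
    using assms unfolding second_deriv0_def by blast
  from d(1,2) have "\<forall>\<^sub>F t in nhds 0. ((\<lambda>t. f t + g t) has_real_derivative f' t + g' t) (at t)"
    by eventually_elim (rule DERIV_add)
  then show ?thesis
    unfolding second_deriv0_def using DERIV_add[OF d(3,4)] by (intro exI conjI)
qed

lemma second_deriv0_minus: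
  assumes "second_deriv0 f a"
  shows "second_deriv0 (\<lambda>t. - f t) (- a)"
proof -
  obtain f' where d: "\<forall>\<^sub>F t in nhds 0. (f has_real_derivative f' t) (at t)"
      "(f' has_real_derivative a) (at 0)"
    using assms unfolding second_deriv0_def by blast
  from d(1) have "\<forall>\<^sub>F t in nhds 0. ((\<lambda>t. - f t) has_real_derivative - f' t) (at t)"
    by eventually_elim (rule DERIV_minus)
  then show ?thesis
    unfolding second_deriv0_def using DERIV_minus[OF d(2)] by (intro exI conjI)
qed

lemma second_deriv0_diff:
  assumes "second_deriv0 f a" "second_deriv0 g b"
  shows "second_deriv0 (\<lambda>t. f t - g t) (a - b)"
  using second_deriv0_add[OF assms(1) second_deriv0_minus[OF assms(2)]] by simp

lemma second_deriv0_reflect: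
  assumes "second_deriv0 f a"
  shows "second_deriv0 (\<lambda>t. f (- t)) a"
proof -
  obtain f' where d: "\<forall>\<^sub>F t in nhds 0. (f has_real_derivative f' t) (at t)"
      "(f' has_real_derivative a) (at 0)"
    using assms unfolding second_deriv0_def by blast
  have "filterlim uminus (nhds 0) (nhds (0::real))"
    using tendsto_minus[OF tendsto_ident_at[of "0::real" UNIV]]
    by (simp add: filterlim_def filtermap_nhds_minus)
  then have "\<forall>\<^sub>F t in nhds 0. (f has_real_derivative f' (- t)) (at (- t))"
    using d(1) by (rule eventually_compose_filterlim[rotated])
  then have "\<forall>\<^sub>F t in nhds 0. ((\<lambda>t. f (- t)) has_real_derivative - f' (- t)) (at t)"
    by eventually_elim (simp add: DERIV_mirror)
  moreover have "((\<lambda>t. - f' (- t)) has_real_derivative a) (at 0)"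
  proof -
    have "((\<lambda>t. f' (- t)) has_real_derivative - a) (at 0)"
      using d(2) DERIV_mirror[of f' a 0] by simp
    from DERIV_minus[OF this] show ?thesis by simp
  qed
  ultimately show ?thesis
    unfolding second_deriv0_def by (intro exI[of _ "\<lambda>t. - f' (- t)"]) simp
qed

lemma second_deriv0_quadratic:
  "second_deriv0 (\<lambda>t. p + q * t + s * t\<^sup>2) (2 * s)"
  unfolding second_deriv0_def
  by (intro exI[of _ "\<lambda>t. q + 2 * s * t"] conjI always_eventually allI)
     (auto intro!: derivative_eq_intros)

lemma second_deriv0_cong:
  assumes "second_deriv0 f a" "\<forall>\<^sub>F t in nhds 0. f t = g t"
  shows "second_deriv0 g a"
proof -
  obtain f' where d: "\<forall>\<^sub>F t in nhds 0. (f has_real_derivative f' t) (at t)"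
      "(f' has_real_derivative a) (at 0)"
    using assms unfolding second_deriv0_def by blast
  from assms(2) have "\<forall>\<^sub>F s in nhds 0. \<forall>\<^sub>F t in nhds s. f t = g t"
    by (simp add: eventually_eventually)
  with d(1) have "\<forall>\<^sub>F t in nhds 0. (g has_real_derivative f' t) (at t)"
    by eventually_elim (use DERIV_cong_ev in blast)
  with d(2) show ?thesis unfolding second_deriv0_def by blast
qed

text \<open>A positive second derivative together with \<open>f' 0 = 0\<close> makes
  \<open>f'\<close> positive just to the right of 0, and the mean value theorem then gives
  \<open>f t > f 0\<close>.\<close>

lemma second_deriv0_le_0:
  assumes "second_deriv0 f a" "\<forall>\<^sub>F t in nhds 0. f t \<le> f 0"
  shows "a \<le> 0"
proof (rule ccontr)
  assume "\<not> a \<le> 0"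
  then have a: "a > 0" by simp
  obtain f' where d: "\<forall>\<^sub>F t in nhds 0. (f has_real_derivative f' t) (at t)"
      "(f' has_real_derivative a) (at 0)"
    using assms unfolding second_deriv0_def by blast
  obtain e1 where e1: "e1 > 0" "\<And>t. \<bar>t\<bar> < e1 \<Longrightarrow> (f has_real_derivative f' t) (at t) \<and> f t \<le> f 0"
    using eventually_conj[OF d(1) assms(2)] unfolding eventually_nhds_metric
    by (auto simp: dist_real_def)
  have "f' 0 = 0"
    by (rule DERIV_local_max[of f "f' 0" 0 e1]) (use e1 in auto)
  moreover obtain e2 where e2: "e2 > 0" "\<And>h. 0 < h \<Longrightarrow> h < e2 \<Longrightarrow> f' 0 < f' (0 + h)"
    using DERIV_pos_inc_right[OF d(2) a] by blast
  ultimately have pos: "0 < f' h" if "0 < h" "h < e2" for h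
    using that by force
  define t where "t = min e1 e2 / 2"
  have t: "0 < t" "t < e1" "t < e2" using e1 e2 by (auto simp: t_def)
  obtain z where z: "0 < z" "z < t" "f t - f 0 = (t - 0) * f' z"
    using MVT2[of 0 t f f'] e1(2) t by force
  have "f t - f 0 > 0" using z t pos[of z] by simp
  with e1(2)[of t] t show False by simp
qed

text \<open>At a maximum with positive value both second derivatives would be \<le> 0. Boundary
  conditions enter through the demand that points with \<open>w z > 0\<close> be interior. The
  directions may depend on the point and the space is arbitrary, so that the doubled domain is
  covered too.\<close>

lemma max_principle:
  fixes K :: "'a::real_normed_vector set"
  assumes K: "compact K" and w: "continuous_on K w"
    and test: "\<And>z. z \<in> K \<Longrightarrow> w z > 0 \<Longrightarrow> z \<in> interior K \<and>
      (\<exists>v1 v2 a b. second_deriv0 (\<lambda>t. w (z + t *\<^sub>R v1)) a \<and>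
         second_deriv0 (\<lambda>t. w (z + t *\<^sub>R v2)) b \<and> a + b > 0)"
    and z: "z \<in> K"
  shows "w z \<le> (0::real)"
proof (rule ccontr)
  assume "\<not> w z \<le> 0"
  obtain p where p: "p \<in> K" "\<And>y. y \<in> K \<Longrightarrow> w y \<le> w p"
    using continuous_attains_sup[OF K _ w] z by blast
  then have "w p > 0" using p(2)[OF z] \<open>\<not> w z \<le> 0\<close> by simp
  with test[OF p(1)] obtain v1 v2 a b where ab: "p \<in> interior K"
      "second_deriv0 (\<lambda>t. w (p + t *\<^sub>R v1)) a"
      "second_deriv0 (\<lambda>t. w (p + t *\<^sub>R v2)) b" "a + b > 0"
    by blast
  have ev: "\<forall>\<^sub>F t in nhds 0. w (p + t *\<^sub>R v) \<le> w (p + 0 *\<^sub>R v)" for v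
  proof -
    have "((\<lambda>t. p + t *\<^sub>R v) \<longlongrightarrow> p + 0 *\<^sub>R v) (nhds 0)"
      by (intro tendsto_intros) (simp add: filterlim_ident)
    then have "\<forall>\<^sub>F t in nhds 0. p + t *\<^sub>R v \<in> interior K"
      by (rule topological_tendstoD) (use ab in auto)
    then show ?thesis
      by eventually_elim (use p interior_subset in auto)
  qed
  have "a \<le> 0" "b \<le> 0"
    using second_deriv0_le_0[OF ab(2) ev] second_deriv0_le_0[OF ab(3) ev] by auto
  with ab(4) show False by simp
qed

section \<open>Second derivatives along lines and the Laplacian of the plane\<close>

lemma has_real_derivative_along:
  fixes f :: "real ^ 'n::finite \<Rightarrow> real"
  assumes "f differentiable (at (x + t *\<^sub>R v))"
  shows "((\<lambda>s. f (x + s *\<^sub>R v)) has_real_derivative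
     (\<Sum>i\<in>UNIV. v $ i * partial_deriv i f (x + t *\<^sub>R v))) (at t)"
proof -
  let ?D = "frechet_derivative f (at (x + t *\<^sub>R v))"
  have D: "(f has_derivative ?D) (at (x + t *\<^sub>R v))"
    using assms by (simp add: frechet_derivative_works)
  then interpret D: bounded_linear ?D by (rule has_derivative_bounded_linear)
  have "((\<lambda>s. x + s *\<^sub>R v) has_derivative (\<lambda>s. s *\<^sub>R v)) (at t)"
    by (auto intro!: derivative_eq_intros)
  from has_derivative_compose[OF this D]
  have "((\<lambda>s. f (x + s *\<^sub>R v)) has_derivative (\<lambda>s. ?D (s *\<^sub>R v))) (at t)" .
  moreover have "?D v = (\<Sum>i\<in>UNIV. v $ i * partial_deriv i f (x + t *\<^sub>R v))"
  proof -
    have "?D v = ?D (\<Sum>i\<in>UNIV. v $ i *\<^sub>R axis i 1)"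
      by (simp add: basis_expansion scalar_mult_eq_scaleR[symmetric])
    also have "\<dots> = (\<Sum>i\<in>UNIV. v $ i * partial_deriv i f (x + t *\<^sub>R v))"
      by (simp add: D.sum D.scaleR partial_deriv_def)
    finally show ?thesis .
  qed
  ultimately show ?thesis
    by (simp add: has_field_derivative_def D.scaleR mult_commute_abs)
qed

lemma second_deriv0_along:
  fixes f :: "real ^ 'n::finite \<Rightarrow> real"
  assumes \<Omega>: "open \<Omega>" "C2_on \<Omega> f" "x \<in> \<Omega>"
  shows "second_deriv0 (\<lambda>t. f (x + t *\<^sub>R v))
     (\<Sum>i\<in>UNIV. v $ i * (\<Sum>j\<in>UNIV. v $ j * partial_deriv j (partial_deriv i f) x))"
  unfolding second_deriv0_def
proof (intro exI conjI)
  have diff: "f differentiable (at y)" "partial_deriv i f differentiable (at y)" if "y \<in> \<Omega>" for y i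
    using assms that unfolding C2_on_def by (auto simp: differentiable_on_eq_differentiable_at)
  have "((\<lambda>t. x + t *\<^sub>R v) \<longlongrightarrow> x + 0 *\<^sub>R v) (nhds 0)"
    by (intro tendsto_intros) (simp add: filterlim_ident)
  then have "\<forall>\<^sub>F t in nhds 0. x + t *\<^sub>R v \<in> \<Omega>"
    by (rule topological_tendstoD) (use \<Omega> in auto)
  then show "\<forall>\<^sub>F t in nhds 0. ((\<lambda>t. f (x + t *\<^sub>R v)) has_real_derivative
      (\<Sum>i\<in>UNIV. v $ i * partial_deriv i f (x + t *\<^sub>R v))) (at t)"
    by eventually_elim (intro has_real_derivative_along diff)
  have "((\<lambda>t. partial_deriv i f (x + t *\<^sub>R v)) has_real_derivative
      (\<Sum>j\<in>UNIV. v $ j * partial_deriv j (partial_deriv i f) x)) (at 0)" for i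
    using has_real_derivative_along[of "partial_deriv i f" x 0 v] diff(2)[OF \<Omega>(3)] by simp
  then show "((\<lambda>t. \<Sum>i\<in>UNIV. v $ i * partial_deriv i f (x + t *\<^sub>R v)) has_real_derivative
     (\<Sum>i\<in>UNIV. v $ i * (\<Sum>j\<in>UNIV. v $ j * partial_deriv j (partial_deriv i f) x))) (at 0)"
    by (intro DERIV_sum DERIV_cmult)
qed

definition perp :: "real ^ 2 \<Rightarrow> real ^ 2" where
  "perp v = vector [- v $ 2, v $ 1]"

lemma perp_nth [simp]: "perp v $ 1 = - v $ 2" "perp v $ 2 = v $ 1"
  by (simp_all add: perp_def)

lemma inner_perp_self [simp]: "v \<bullet> perp v = 0" "perp v \<bullet> v = 0"
  by (simp_all add: inner_vec_def UNIV_2)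

lemma norm_perp [simp]: "norm (perp v) = norm v"
  by (simp add: norm_vec_def UNIV_2 L2_set_def)

lemma perp_expansion:
  assumes "norm n = 1"
  shows "z = (z \<bullet> n) *\<^sub>R n + (z \<bullet> perp n) *\<^sub>R perp n"
proof -
  have n: "(n $ 1)\<^sup>2 + (n $ 2)\<^sup>2 = 1"
    using assms by (simp add: norm_vec_def UNIV_2 L2_set_def)
  have "z $ 1 * ((n $ 1)\<^sup>2 + (n $ 2)\<^sup>2) = (z $ 1 * n $ 1 + z $ 2 * n $ 2) * n $ 1
      - (z $ 2 * n $ 1 - z $ 1 * n $ 2) * n $ 2"
    "z $ 2 * ((n $ 1)\<^sup>2 + (n $ 2)\<^sup>2) = (z $ 1 * n $ 1 + z $ 2 * n $ 2) * n $ 2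
      + (z $ 2 * n $ 1 - z $ 1 * n $ 2) * n $ 1"
    by (simp_all add: algebra_simps power2_eq_square)
  then show ?thesis
    unfolding n by (simp add: vec_eq_iff forall_2 inner_vec_def UNIV_2 algebra_simps)
qed

text \<open>Rotation invariance of the Laplacian: the mixed terms along \<open>n\<close> and
  \<open>perp n\<close> cancel, and the squared coordinates of \<open>n\<close> add up to 1.\<close>

lemma second_deriv0_laplacian:
  fixes f :: "real ^ 2 \<Rightarrow> real"
  assumes "open \<Omega>" "C2_on \<Omega> f" "x \<in> \<Omega>" "norm n = 1"
  shows "\<exists>a b. second_deriv0 (\<lambda>t. f (x + t *\<^sub>R n)) a \<and>
    second_deriv0 (\<lambda>t. f (x + t *\<^sub>R perp n)) b \<and> a + b = laplacian f x"
proof (intro exI conjI)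
  let ?S = "\<lambda>v. (\<Sum>i\<in>UNIV. v $ i * (\<Sum>j\<in>UNIV. v $ j * partial_deriv j (partial_deriv i f) x))"
  show "second_deriv0 (\<lambda>t. f (x + t *\<^sub>R n)) (?S n)"
    "second_deriv0 (\<lambda>t. f (x + t *\<^sub>R perp n)) (?S (perp n))"
    using assms by (auto intro: second_deriv0_along)
  have n: "(n $ 1)\<^sup>2 + (n $ 2)\<^sup>2 = 1"
    using assms by (simp add: norm_vec_def UNIV_2 L2_set_def)
  have "?S n + ?S (perp n) = ((n $ 1)\<^sup>2 + (n $ 2)\<^sup>2) * laplacian f x"
    by (simp add: UNIV_2 laplacian_def algebra_simps power2_eq_square)
  then show "?S n + ?S (perp n) = laplacian f x" unfolding n by simp
qed

text \<open>The maximum principle for \<open>f - H\<close>, where \<open>H\<close> is quadratic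
  along both directions with constant second derivatives \<open>2 * s1\<close> and
  \<open>2 * s2\<close>. The barriers on the domain itself are all of this kind.\<close>

lemma quadratic_comparison:
  fixes f H :: "'a::real_normed_vector \<Rightarrow> real"
  assumes K: "compact K" and f: "continuous_on K f" and H: "continuous_on K H"
    and H1: "\<And>z t. H (z + t *\<^sub>R v1) = H z + q1 z * t + s1 * t\<^sup>2"
    and H2: "\<And>z t. H (z + t *\<^sub>R v2) = H z + q2 z * t + s2 * t\<^sup>2"
    and test: "\<And>z. z \<in> K \<Longrightarrow> f z > H z \<Longrightarrow> z \<in> interior K \<and>
      (\<exists>a b. second_deriv0 (\<lambda>t. f (z + t *\<^sub>R v1)) a \<and>
         second_deriv0 (\<lambda>t. f (z + t *\<^sub>R v2)) b \<and> a + b > 2 * (s1 + s2))"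
    and z: "z \<in> K"
  shows "f z \<le> H z"
proof -
  have "f z - H z \<le> 0"
  proof (rule max_principle[OF K _ _ z])
    show "continuous_on K (\<lambda>z. f z - H z)"
      by (intro continuous_intros f H)
    fix p assume p: "p \<in> K" "0 < f p - H p"
    with test[of p] obtain a b where ab: "p \<in> interior K"
        "second_deriv0 (\<lambda>t. f (p + t *\<^sub>R v1)) a"
        "second_deriv0 (\<lambda>t. f (p + t *\<^sub>R v2)) b" "a + b > 2 * (s1 + s2)"
      by auto
    have "second_deriv0 (\<lambda>t. f (p + t *\<^sub>R v1) - H (p + t *\<^sub>R v1)) (a - 2 * s1)"
      "second_deriv0 (\<lambda>t. f (p + t *\<^sub>R v2) - H (p + t *\<^sub>R v2)) (b - 2 * s2)"
      unfolding H1 H2 by (intro second_deriv0_diff ab second_deriv0_quadratic)+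
    with ab show "p \<in> interior K \<and>
      (\<exists>v1 v2 a b. second_deriv0 (\<lambda>t. f (p + t *\<^sub>R v1) - H (p + t *\<^sub>R v1)) a \<and>
         second_deriv0 (\<lambda>t. f (p + t *\<^sub>R v2) - H (p + t *\<^sub>R v2)) b \<and> a + b > 0)"
      by (intro conjI exI[of _ v1] exI[of _ v2] exI[of _ "a - 2 * s1"] exI[of _ "b - 2 * s2"]) auto
  qed
  then show ?thesis by simp
qed

section \<open>The Lipschitz bound\<close>

text \<open>A hyperplane separating the boundary point from the domain, with its normal scaled to
  length 1 and pointing inward.\<close>

lemma supporting_normal_exists:
  fixes \<Omega> :: "'a::euclidean_space set"
  assumes \<Omega>: "open \<Omega>" "convex \<Omega>" "\<Omega> \<noteq> {}" and x: "x \<in> frontier \<Omega>"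
  obtains n where "norm n = 1" "\<And>y. y \<in> \<Omega> \<Longrightarrow> (y - x) \<bullet> n \<ge> 0"
proof -
  have "x \<notin> \<Omega>" using \<Omega> x by (auto simp: frontier_def interior_open)
  then obtain a b where ab: "a \<noteq> 0" "a \<bullet> x \<le> b" "\<And>y. y \<in> \<Omega> \<Longrightarrow> a \<bullet> y \<ge> b"
    using separating_hyperplane_sets[of "{x}" \<Omega>] \<Omega> by auto
  have "(y - x) \<bullet> (a /\<^sub>R norm a) \<ge> 0" if "y \<in> \<Omega>" for y
  proof -
    have "a \<bullet> (y - x) \<ge> 0" using ab(2) ab(3)[OF that] by (simp add: inner_diff_right)
    then show ?thesis by (simp add: inner_commute)
  qed
  with that[of "a /\<^sub>R norm a"] ab(1) show ?thesis by auto
qed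

section \<open>Barriers for eigenfunctions on a bounded convex domain\<close>

text \<open>The equation is kept as a sum of second derivatives in every rotated orthonormal frame,
  so that each comparison may use the frame of its own normal. The assumptions are stable under
  \<open>u\<close> to \<open>-u\<close>, which turns upper bounds into bounds of the absolute
  value.\<close>

locale membrane =
  fixes \<Omega> :: "(real ^ 2) set" and lam :: real and u :: "real ^ 2 \<Rightarrow> real"
  assumes open_dom: "open \<Omega>" and nonempty: "\<Omega> \<noteq> {}"
    and bounded_dom: "bounded \<Omega>" and convex_dom: "convex \<Omega>"
    and cont: "continuous_on (closure \<Omega>) u"
    and zero: "x \<in> frontier \<Omega> \<Longrightarrow> u x = 0"
    and pde: "x \<in> \<Omega> \<Longrightarrow> norm n = 1 \<Longrightarrow> \<exists>a b. second_deriv0 (\<lambda>t. u (x + t *\<^sub>R n)) a \<and>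
      second_deriv0 (\<lambda>t. u (x + t *\<^sub>R perp n)) b \<and> a + b = - lam * u x"
begin

lemma membrane_minus: "membrane \<Omega> lam (\<lambda>x. - u x)"
proof
  fix x n :: "real ^ 2" assume "x \<in> \<Omega>" "norm n = 1"
  from pde[OF this] obtain a b where "second_deriv0 (\<lambda>t. u (x + t *\<^sub>R n)) a"
      "second_deriv0 (\<lambda>t. u (x + t *\<^sub>R perp n)) b" "a + b = - lam * u x"
    by blast
  then show "\<exists>a b. second_deriv0 (\<lambda>t. - u (x + t *\<^sub>R n)) a \<and>
      second_deriv0 (\<lambda>t. - u (x + t *\<^sub>R perp n)) b \<and> a + b = - lam * - u x"
    by (intro exI[of _ "- a"] exI[of _ "- b"]) (auto intro: second_deriv0_minus)
qed (use open_dom nonempty bounded_dom convex_dom zero in \<open>auto intro: continuous_on_minus cont\<close>)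

lemma compact_closure_dom: "compact (closure \<Omega>)"
  using bounded_dom by (simp add: compact_closure)

lemma in_dom: "z \<in> closure \<Omega> \<Longrightarrow> u z \<noteq> 0 \<Longrightarrow> z \<in> \<Omega>"
  using zero[of z] open_dom by (auto simp: frontier_def interior_open)

lemma interior_closure_dom: "z \<in> \<Omega> \<Longrightarrow> z \<in> interior (closure \<Omega>)"
  using open_dom closure_subset interior_maximal by blast

text \<open>For \<open>lam\<close> \<le> 0 the function is subharmonic where it is positive. The
  strict inequality required by the comparison comes from a small concave barrier, whose size
  \<open>e\<close> is then sent to 0.\<close>

lemma nonpos_if_lam_nonpos:
  assumes lam: "lam \<le> 0" and z: "z \<in> closure \<Omega>"
  shows "u z \<le> 0"
proof -
  define n :: "real ^ 2" where "n = axis 1 1"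
  have n: "norm n = 1" by (simp add: n_def norm_axis_1)
  obtain D where D: "\<And>z. z \<in> closure \<Omega> \<Longrightarrow> norm z \<le> D"
    using compact_imp_bounded[OF compact_closure_dom] unfolding bounded_iff by blast
  have nD: "(z \<bullet> n)\<^sup>2 \<le> D\<^sup>2" if "z \<in> closure \<Omega>" for z
    using D[OF that] Cauchy_Schwarz_ineq2[of z n] n by (auto simp: abs_le_square_iff[symmetric])
  have "u z \<le> 0 + e" if e: "e > 0" for e
  proof -
    \<comment> \<open>This scale keeps the barrier between 0 and \<open>e\<close> on the closure;
      the summand 1 keeps the denominator positive.\<close>
    define c where "c = e / (D\<^sup>2 + 1)"
    have D1: "D\<^sup>2 + 1 > 0" by (intro add_nonneg_pos) auto
    then have "c * (D\<^sup>2 + 1) = e" by (simp add: c_def)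
    moreover have c0: "c > 0" using e D1 by (simp add: c_def)
    ultimately have c: "c > 0" "c * D\<^sup>2 \<le> e" by (auto simp: algebra_simps)
    have "u z \<le> c * D\<^sup>2 - c * (z \<bullet> n)\<^sup>2"
    proof (rule quadratic_comparison[OF compact_closure_dom cont, where ?v1.0 = n
          and ?v2.0 = "perp n" and ?q1.0 = "\<lambda>z. - 2 * c * (z \<bullet> n)" and ?s1.0 = "- c" and ?q2.0 = "\<lambda>_. 0" and ?s2.0 = 0])
      fix p assume p: "p \<in> closure \<Omega>" "u p > c * D\<^sup>2 - c * (p \<bullet> n)\<^sup>2"
      have "c * (p \<bullet> n)\<^sup>2 \<le> c * D\<^sup>2"
        using c nD[OF p(1)] by simp
      with p have up: "u p > 0" by simp
      then have "p \<in> \<Omega>" using in_dom p by auto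
      moreover have "lam * u p \<le> 0" using lam up by (simp add: mult_le_0_iff)
      ultimately show "p \<in> interior (closure \<Omega>) \<and> (\<exists>a b. second_deriv0 (\<lambda>t. u (p + t *\<^sub>R n)) a \<and>
           second_deriv0 (\<lambda>t. u (p + t *\<^sub>R perp n)) b \<and> a + b > 2 * (- c + 0))"
        using pde[of p n] n interior_closure_dom c by (smt (verit) mult_minus_left)
    qed (use n z in \<open>auto intro!: continuous_intros simp: inner_add_left power2_eq_square algebra_simps
          dot_square_norm\<close>)
    also have "\<dots> \<le> e" using c nD[OF z] by (smt (verit) mult_nonneg_nonneg zero_le_power2)
    finally show ?thesis by simp
  qed
  then show ?thesis by (rule field_le_epsilon)
qed

lemma lam_pos:
  assumes "x \<in> \<Omega>" "u x \<noteq> 0"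
  shows "lam > 0"
proof (rule ccontr)
  assume "\<not> lam > 0"
  then have "u x \<le> 0" "- u x \<le> 0"
    using nonpos_if_lam_nonpos[of x] membrane.nonpos_if_lam_nonpos[OF membrane_minus, of x]
      assms closure_subset by auto
  with assms show False by simp
qed

lemma support_closure:
  assumes "\<And>y. y \<in> \<Omega> \<Longrightarrow> (y - x) \<bullet> n \<ge> 0" "z \<in> closure \<Omega>"
  shows "(z - x) \<bullet> n \<ge> 0"
proof -
  have "closed {z. (z - x) \<bullet> n \<ge> 0}"
    by (intro closed_Collect_le continuous_intros)
  then have "closure \<Omega> \<subseteq> {z. (z - x) \<bullet> n \<ge> 0}"
    by (intro closure_minimal) (use assms in auto)
  then show ?thesis using assms by blast
qed

text \<open>In the strip of width \<open>s\<close> along the supporting line, with \<open>b\<close>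
  the distance to it, the barrier is \<open>K * b * (2 * s - b)\<close>. It is nonnegative, reaches
  \<open>K * s\<^sup>2\<close> \<ge> \<open>M\<close> at the far side, and has Laplacian
  \<open>- 2 * K\<close>, strictly below that of \<open>u\<close>.\<close>

lemma barrier:
  assumes n: "norm n = 1" and supp: "\<And>y. y \<in> \<Omega> \<Longrightarrow> (y - x) \<bullet> n \<ge> 0"
    and M: "\<And>z. z \<in> closure \<Omega> \<Longrightarrow> \<bar>u z\<bar> \<le> M"
    and K: "\<bar>lam\<bar> * M < 2 * K" "M \<le> K * s\<^sup>2" and s: "s > 0"
    and z: "z \<in> closure \<Omega>" "(z - x) \<bullet> n \<le> s"
  shows "u z \<le> 2 * K * s * ((z - x) \<bullet> n) - K * ((z - x) \<bullet> n)\<^sup>2"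
proof -
  have "0 \<le> M" using M[OF z(1)] by simp
  then have K0: "K > 0" using K by (smt (verit) abs_ge_zero mult_nonneg_nonneg)
  let ?S = "closure \<Omega> \<inter> {z. (z - x) \<bullet> n \<le> s}"
  have S: "compact ?S"
    by (intro compact_Int_closed compact_closure_dom closed_Collect_le continuous_intros)
  have cS: "continuous_on ?S u" by (rule continuous_on_subset[OF cont]) auto
  show ?thesis
  proof (rule quadratic_comparison[OF S cS, where ?v1.0 = n and ?v2.0 = "perp n"
        and ?q1.0 = "\<lambda>z. 2 * K * s - 2 * K * ((z - x) \<bullet> n)" and ?s1.0 = "- K" and ?q2.0 = "\<lambda>_. 0" and ?s2.0 = 0])
    fix p assume p: "p \<in> ?S" "u p > 2 * K * s * ((p - x) \<bullet> n) - K * ((p - x) \<bullet> n)\<^sup>2"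
    define b where "b = (p - x) \<bullet> n"
    have b: "0 \<le> b" "b \<le> s" "u p > 2 * K * s * b - K * b\<^sup>2"
      using p support_closure[OF supp] by (auto simp: b_def)
    have "2 * K * s * b - K * b\<^sup>2 = K * b * (s + (s - b))"
      by (simp add: power2_eq_square algebra_simps)
    also have "\<dots> \<ge> 0" using b K0 s by (intro mult_nonneg_nonneg) auto
    finally have up: "u p > 0" using b by simp
    then have pO: "p \<in> \<Omega>" using in_dom p by auto
    have "b \<noteq> s"
    proof
      assume "b = s"
      then have "2 * K * s * b - K * b\<^sup>2 = K * s\<^sup>2" by (simp add: power2_eq_square)
      then show False using b K M[of p] p by force
    qed
    then have "p \<in> \<Omega> \<inter> {z. (z - x) \<bullet> n < s}" using b pO by (auto simp: b_def)
    then have int: "p \<in> interior ?S"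
    proof (rule interiorI[rotated])
      show "open (\<Omega> \<inter> {z. (z - x) \<bullet> n < s})"
        by (intro open_Int open_dom open_Collect_less continuous_intros)
    qed (use closure_subset in auto)
    have "lam * u p \<le> \<bar>lam\<bar> * M"
      by (rule mult_mono) (use up M[of p] p in auto)
    with int show "p \<in> interior ?S \<and> (\<exists>a b. second_deriv0 (\<lambda>t. u (p + t *\<^sub>R n)) a \<and>
           second_deriv0 (\<lambda>t. u (p + t *\<^sub>R perp n)) b \<and> a + b > 2 * (- K + 0))"
      using pde[OF pO n] K by (smt (verit) mult_minus_left)
  qed (use n z in \<open>auto intro!: continuous_intros simp: inner_add_left inner_diff_left power2_eq_square algebra_simps
          dot_square_norm\<close>)
qed

end

locale bounded_membrane = membrane +
  fixes M :: real
  assumes lam: "lam > 0" and M_pos: "M > 0" and M: "\<And>z. z \<in> closure \<Omega> \<Longrightarrow> \<bar>u z\<bar> \<le> M"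
begin

definition "lip = 4 * sqrt lam * M"

lemma bounded_membrane_minus: "bounded_membrane \<Omega> lam (\<lambda>x. - u x) M"
  using membrane_minus lam M_pos M by (simp add: bounded_membrane_def bounded_membrane_axioms_def)

text \<open>The barrier with \<open>K = 2 * lam * M\<close> on a strip of width
  \<open>1 / sqrt lam\<close>: a concave parabola with slope \<open>lip\<close> at 0. Its vertex is
  at \<open>1 / sqrt lam\<close> and has height \<open>2 * M\<close>, enough to dominate any
  difference of two values of \<open>u\<close>.\<close>

definition "profile s = lip * s - 2 * lam * M * s\<^sup>2"

lemma profile_mono:
  assumes "0 \<le> s" "s \<le> t" "t \<le> 1 / sqrt lam"
  shows "profile s \<le> profile t"
proof -
  have "lam = sqrt lam * sqrt lam" using lam by simp
  then have "profile t - profile s = 4 * sqrt lam * M * (t - s) - 2 * (sqrt lam * sqrt lam) * M * (t\<^sup>2 - s\<^sup>2)"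
    by (simp add: profile_def lip_def algebra_simps)
  also have "\<dots> = 2 * sqrt lam * M * (t - s) * (2 - sqrt lam * (t + s))"
    by algebra
  also have "\<dots> \<ge> 0"
  proof -
    have "sqrt lam * (t + s) \<le> sqrt lam * (2 / sqrt lam)"
      using assms lam by (intro mult_left_mono) auto
    then show ?thesis using assms lam M_pos by (intro mult_nonneg_nonneg) auto
  qed
  finally show ?thesis by simp
qed

lemma profile_le: "profile s \<le> lip * s"
  using lam M_pos by (simp add: profile_def)

lemma profile_end: "profile (1 / sqrt lam) = 2 * M"
  using lam by (simp add: profile_def lip_def power2_eq_square)

lemma abs_le_profile_support:
  assumes n: "norm n = 1" and supp: "\<And>y. y \<in> \<Omega> \<Longrightarrow> (y - x) \<bullet> n \<ge> 0"
    and z: "z \<in> closure \<Omega>" "(z - x) \<bullet> n \<le> 1 / sqrt lam"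
  shows "\<bar>u z\<bar> \<le> profile ((z - x) \<bullet> n)"
proof -
  define K where "K = 2 * lam * M"
  have K: "\<bar>lam\<bar> * M < 2 * K" "M \<le> K * (1 / sqrt lam)\<^sup>2" "1 / sqrt lam > 0"
    using lam M_pos by (auto simp: K_def power_divide)
  have *: "2 * K * (1 / sqrt lam) * b - K * b\<^sup>2 = profile b" for b
  proof -
    have "lam * (1 / sqrt lam) = sqrt lam" using lam by (simp add: real_div_sqrt)
    moreover have "2 * K * (1 / sqrt lam) * b = 4 * (lam * (1 / sqrt lam)) * M * b"
      by (simp add: K_def)
    ultimately show ?thesis by (simp only: profile_def lip_def K_def)
  qed
  show ?thesis
    using barrier[OF n supp M K z] membrane.barrier[OF membrane_minus n supp _ K z] M
    unfolding * by auto
qed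

text \<open>Within the strip the parabola lies below its tangent at 0; beyond the strip that tangent
  already exceeds \<open>2 * M\<close>.\<close>

lemma abs_le_support:
  assumes n: "norm n = 1" and supp: "\<And>y. y \<in> \<Omega> \<Longrightarrow> (y - x) \<bullet> n \<ge> 0"
    and z: "z \<in> closure \<Omega>"
  shows "\<bar>u z\<bar> \<le> lip * ((z - x) \<bullet> n)"
proof (cases "(z - x) \<bullet> n \<le> 1 / sqrt lam")
  case True
  then show ?thesis using abs_le_profile_support[OF n supp z] profile_le order_trans by blast
next
  case False
  have "\<bar>u z\<bar> \<le> 2 * M" using M[OF z] M_pos by simp
  also have "\<dots> \<le> lip * (1 / sqrt lam)" using profile_end profile_le by metis
  also have "\<dots> \<le> lip * ((z - x) \<bullet> n)"
    using False lam M_pos by (intro mult_left_mono) (auto simp: lip_def)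
  finally show ?thesis .
qed

text \<open>The distance to a supporting line at \<open>x\<close> is at most the distance to
  \<open>x\<close>, and \<open>profile\<close> increases up to its vertex. This settles pairs with
  one point on the boundary in the doubling argument.\<close>

lemma abs_le_profile_frontier:
  assumes x: "x \<in> frontier \<Omega>" and z: "z \<in> closure \<Omega>" "norm (z - x) \<le> 1 / sqrt lam"
  shows "\<bar>u z\<bar> \<le> profile (norm (z - x))"
proof -
  obtain n where n: "norm n = 1" "\<And>y. y \<in> \<Omega> \<Longrightarrow> (y - x) \<bullet> n \<ge> 0"
    using supporting_normal_exists[OF open_dom convex_dom nonempty x] by blast
  have "(z - x) \<bullet> n \<le> norm (z - x)" using norm_cauchy_schwarz[of "z - x" n] n by simp
  then show ?thesis
    using abs_le_profile_support[OF n, of z] z profile_mono[of "(z - x) \<bullet> n" "norm (z - x)"]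
      support_closure[OF n(2) z(1)]
    by force
qed

text \<open>Doubling of variables. At an interior maximum of \<open>u x - u y - profile \<bar>x - y\<bar>\<close> the second-order
  test is applied to moving \<open>x\<close> and \<open>y\<close> apart along \<open>x - y\<close> and to translating both orthogonally to it.\<close>

lemma diff_le_profile:
  assumes "x \<in> closure \<Omega>" "y \<in> closure \<Omega>" "norm (x - y) \<le> 1 / sqrt lam"
  shows "u x - u y \<le> profile (norm (x - y))"
proof -
  define w where "w p = u (fst p) - u (snd p) - profile (norm (fst p - snd p))" for p
  let ?K = "(closure \<Omega> \<times> closure \<Omega>) \<inter> {p. norm (fst p - snd p) \<le> 1 / sqrt lam}"
  have "w (x, y) \<le> 0"
  proof (rule max_principle[where K = ?K])
    show "compact ?K"
      by (intro compact_Int_closed compact_Times compact_closure_dom closed_Collect_le continuous_intros)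
    show "continuous_on ?K w"
      unfolding w_def profile_def
      by (intro continuous_intros continuous_on_compose2[OF cont]) auto
    show "(x, y) \<in> ?K" using assms by auto
    fix p assume p: "p \<in> ?K" "0 < w p"
    obtain x y where pxy: "p = (x, y)" by (cases p)
    define r where "r = norm (x - y)"
    have xy: "x \<in> closure \<Omega>" "y \<in> closure \<Omega>" "r \<le> 1 / sqrt lam" and wp: "u x - u y > profile r"
      using p by (auto simp: pxy w_def r_def)
    have "r > 0"
      using wp by (cases "x = y") (auto simp: r_def profile_def)
    \<comment> \<open>At the maximal separation the profile equals \<open>2 * M\<close>, which no
      difference of values of \<open>u\<close> exceeds.\<close>
    have "r \<noteq> 1 / sqrt lam"
      using wp profile_end M[OF xy(1)] M[OF xy(2)] by force
    then have r: "r < 1 / sqrt lam" using xy by simp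
    have x: "x \<in> \<Omega>"
    proof (rule ccontr)
      assume "x \<notin> \<Omega>"
      then have "x \<in> frontier \<Omega>" using xy open_dom by (simp add: frontier_def interior_open)
      then show False
        using abs_le_profile_frontier[of x y] zero[of x] wp xy by (auto simp: r_def norm_minus_commute)
    qed
    have y: "y \<in> \<Omega>"
    proof (rule ccontr)
      assume "y \<notin> \<Omega>"
      then have "y \<in> frontier \<Omega>" using xy open_dom by (simp add: frontier_def interior_open)
      then show False
        using abs_le_profile_frontier[of y x] zero[of y] wp xy by (auto simp: r_def norm_minus_commute)
    qed
    define e where "e = (x - y) /\<^sub>R r"
    have e: "norm e = 1" "x - y = r *\<^sub>R e"
      using \<open>r > 0\<close> by (auto simp: e_def r_def)
    have "p \<in> (\<Omega> \<times> \<Omega>) \<inter> {p. norm (fst p - snd p) < 1 / sqrt lam}"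
      using x y r by (auto simp: pxy r_def)
    then have int: "p \<in> interior ?K"
    proof (rule interiorI[rotated])
      show "open ((\<Omega> \<times> \<Omega>) \<inter> {p. norm (fst p - snd p) < 1 / sqrt lam})"
        by (intro open_Int open_Times open_dom open_Collect_less continuous_intros)
    qed (use closure_subset in auto)
    obtain a1 b1 where 1: "second_deriv0 (\<lambda>t. u (x + t *\<^sub>R e)) a1"
      "second_deriv0 (\<lambda>t. u (x + t *\<^sub>R perp e)) b1" "a1 + b1 = - lam * u x"
      using pde[OF x e(1)] by blast
    obtain a2 b2 where 2: "second_deriv0 (\<lambda>t. u (y + t *\<^sub>R e)) a2"
      "second_deriv0 (\<lambda>t. u (y + t *\<^sub>R perp e)) b2" "a2 + b2 = - lam * u y"
      using pde[OF y e(1)] by blast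
    \<comment> \<open>Both points move, so their distance is \<open>r + 2 * t\<close> and the second
      derivative of the profile is multiplied by 4. The restriction \<open>t > - r / 2\<close> keeps
      this distance positive.\<close>
    have prof: "second_deriv0 (\<lambda>t. profile (norm (x + t *\<^sub>R e - (y - t *\<^sub>R e)))) (2 * (- 8 * lam * M))"
    proof (rule second_deriv0_cong[OF second_deriv0_quadratic])
      have "\<forall>\<^sub>F t in nhds 0. t \<in> {- (r/2)<..}"
        by (rule eventually_nhds_in_open) (use \<open>r > 0\<close> in auto)
      then show "\<forall>\<^sub>F t in nhds 0. profile r + (2 * lip - 8 * lam * M * r) * t + (- 8 * lam * M) * t\<^sup>2 =
          profile (norm (x + t *\<^sub>R e - (y - t *\<^sub>R e)))"
      proof eventually_elim
        case (elim t)
        have "x + t *\<^sub>R e - (y - t *\<^sub>R e) = (r + 2 * t) *\<^sub>R e"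
          using e(2) by (simp add: algebra_simps scaleR_2 flip: scaleR_scaleR)
        then have "norm (x + t *\<^sub>R e - (y - t *\<^sub>R e)) = r + 2 * t"
          using e(1) elim by simp
        then show ?case by (simp add: profile_def power2_eq_square algebra_simps)
      qed
    qed
    have u2: "second_deriv0 (\<lambda>t. u (y - t *\<^sub>R e)) a2"
      using second_deriv0_reflect[OF 2(1)] by simp
    have const: "second_deriv0 (\<lambda>t. profile (norm (x - y))) (2 * 0)"
      using second_deriv0_quadratic[of "profile (norm (x - y))" 0 0] by simp
    have "second_deriv0 (\<lambda>t. w (p + t *\<^sub>R (e, - e))) (a1 - a2 - 2 * (- 8 * lam * M))"
      using second_deriv0_diff[OF second_deriv0_diff[OF 1(1) u2] prof] by (simp add: w_def pxy)
    moreover have "second_deriv0 (\<lambda>t. w (p + t *\<^sub>R (perp e, perp e))) (b1 - b2 - 2 * 0)"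
      using second_deriv0_diff[OF second_deriv0_diff[OF 1(2) 2(2)] const] by (simp add: w_def pxy)
    \<comment> \<open>The equation contributes at least \<open>- 2 * lam * M\<close>, while the
      concavity of the profile contributes \<open>16 * lam * M\<close>.\<close>
    moreover have "a1 - a2 - 2 * (- 8 * lam * M) + (b1 - b2 - 2 * 0) > 0"
    proof -
      have "lam * (u x - u y) \<le> lam * (2 * M)"
        using M[OF xy(1)] M[OF xy(2)] lam by (intro mult_left_mono) auto
      moreover have "lam * M > 0" using lam M_pos by simp
      ultimately show ?thesis using 1(3) 2(3) by (simp add: algebra_simps)
    qed
    ultimately show "p \<in> interior ?K \<and> (\<exists>v1 v2 a b. second_deriv0 (\<lambda>t. w (p + t *\<^sub>R v1)) a \<and>
           second_deriv0 (\<lambda>t. w (p + t *\<^sub>R v2)) b \<and> a + b > 0)"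
      using int by blast
  qed
  then show ?thesis by (simp add: w_def)
qed

lemma lipschitz:
  assumes "x \<in> closure \<Omega>" "y \<in> closure \<Omega>"
  shows "\<bar>u x - u y\<bar> \<le> lip * norm (x - y)"
proof (cases "norm (x - y) \<le> 1 / sqrt lam")
  case True
  then show ?thesis
    using diff_le_profile[of x y] diff_le_profile[of y x] assms profile_le[of "norm (x - y)"]
    by (auto simp: norm_minus_commute abs_le_iff)
next
  case False
  have "\<bar>u x - u y\<bar> \<le> 2 * M" using M[OF assms(1)] M[OF assms(2)] by simp
  also have "\<dots> \<le> lip * (1 / sqrt lam)" using profile_end profile_le by metis
  also have "\<dots> \<le> lip * norm (x - y)"
    using False lam M_pos by (intro mult_left_mono) (auto simp: lip_def)
  finally show ?thesis .
qed

section \<open>Size of the maximum from the normalization\<close>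

text \<open>The radius is chosen so that \<open>lip\<close> times it equals \<open>M / 2\<close>.
  The ball cannot leave the domain, for a segment leaving it would meet the boundary, where
  \<open>u\<close> vanishes, before \<open>u\<close> could drop by \<open>M / 2\<close>.\<close>

lemma half_ball:
  assumes x0: "x0 \<in> closure \<Omega>" "\<bar>u x0\<bar> = M" and z: "z \<in> ball x0 (1 / (8 * sqrt lam))"
  shows "z \<in> \<Omega> \<and> M / 2 \<le> \<bar>u z\<bar>"
proof -
  have lip0: "lip > 0" using lam M_pos by (simp add: lip_def)
  have close: "\<bar>u x0\<bar> - \<bar>u p\<bar> < M / 2" if "p \<in> closure \<Omega>" "norm (p - x0) < 1 / (8 * sqrt lam)" for p
  proof -
    have "\<bar>u x0\<bar> - \<bar>u p\<bar> \<le> \<bar>u p - u x0\<bar>" by linarith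
    also have "\<dots> \<le> lip * norm (p - x0)" by (rule lipschitz[OF that(1) x0(1)])
    also have "\<dots> < lip * (1 / (8 * sqrt lam))"
      using that lip0 by (intro mult_strict_left_mono)
    also have "\<dots> = M / 2" using lam by (simp add: lip_def)
    finally show ?thesis .
  qed
  have nz: "norm (z - x0) < 1 / (8 * sqrt lam)" using z by (simp add: dist_norm norm_minus_commute)
  have "z \<in> \<Omega>"
  proof (rule ccontr)
    assume nin: "z \<notin> \<Omega>"
    have "x0 \<in> \<Omega>" using in_dom x0 M_pos by auto
    then have "closed_segment x0 z \<inter> frontier \<Omega> \<noteq> {}"
      using nin by (intro connected_Int_frontier) auto
    then obtain p where p: "p \<in> closed_segment x0 z" "p \<in> frontier \<Omega>" by blast
    have "norm (p - x0) \<le> norm (z - x0)" using p(1) by (rule segment_bound)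
    then show False using close[of p] p(2) zero[of p] nz x0 M_pos by (auto simp: frontier_def)
  qed
  moreover have "M / 2 \<le> \<bar>u z\<bar>" using close[of z] nz \<open>z \<in> \<Omega>\<close> closure_subset x0 by force
  ultimately show ?thesis by simp
qed

lemma lip_le:
  assumes x0: "x0 \<in> closure \<Omega>" "\<bar>u x0\<bar> = M" and L2: "L2_normalized \<Omega> u"
  shows "lip \<le> 64 * lam"
proof -
  define \<rho> where "\<rho> = 1 / (8 * sqrt lam)"
  define B where "B = ball x0 \<rho>"
  have \<rho>: "\<rho> > 0" using lam by (simp add: \<rho>_def)
  have one: "(\<integral>x. indicator \<Omega> x * (u x)\<^sup>2 \<partial>lborel) = 1"
    using L2 by (simp add: L2_normalized_def set_lebesgue_integral_def)
  \<comment> \<open>A function that is not integrable has integral 0 by convention, so the value 1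
    forces integrability.\<close>
  then have int: "integrable lborel (\<lambda>x. indicator \<Omega> x * (u x)\<^sup>2)"
    using not_integrable_integral_eq by fastforce
  have "emeasure lborel B < \<infinity>" unfolding B_def by (rule emeasure_bounded_finite) simp
  then have intB: "integrable lborel (indicat_real B)"
    by (simp add: B_def)
  have "(\<integral>x. M\<^sup>2 / 4 * indicator B x \<partial>lborel) \<le> (\<integral>x. indicator \<Omega> x * (u x)\<^sup>2 \<partial>lborel)"
  proof (rule integral_mono[OF integrable_mult_right[OF intB] int])
    fix x
    show "M\<^sup>2 / 4 * indicator B x \<le> indicator \<Omega> x * (u x)\<^sup>2"
    proof (cases "x \<in> B")
      case True
      then have "x \<in> \<Omega>" "M / 2 \<le> \<bar>u x\<bar>"
        using half_ball[OF x0] by (auto simp: B_def \<rho>_def)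
      then have "(M / 2)\<^sup>2 \<le> (u x)\<^sup>2" using M_pos by (simp add: abs_le_square_iff[symmetric])
      with True \<open>x \<in> \<Omega>\<close> show ?thesis by (simp add: power_divide)
    qed simp
  qed
  moreover have "(\<integral>x. M\<^sup>2 / 4 * indicator B x \<partial>lborel) = M\<^sup>2 / 4 * (pi * \<rho>\<^sup>2)"
    using \<rho> by (simp add: B_def content_ball unit_ball_vol_2)
  ultimately have "M\<^sup>2 / 4 * (pi * \<rho>\<^sup>2) \<le> 1" using one by linarith
  \<comment> \<open>The crude bound \<open>pi\<close> \<ge> 1 makes the constants integers:
    \<open>M\<^sup>2 \<le> 256 * lam\<close>.\<close>
  moreover have "M\<^sup>2 / 4 * (1 * \<rho>\<^sup>2) \<le> M\<^sup>2 / 4 * (pi * \<rho>\<^sup>2)"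
    using pi_gt3 by (intro mult_left_mono mult_right_mono) auto
  moreover have "\<rho>\<^sup>2 = 1 / (64 * lam)" using lam by (simp add: \<rho>_def power_divide power_mult_distrib)
  ultimately have "M\<^sup>2 \<le> 256 * lam" using lam by (simp add: field_simps)
  also have "\<dots> = (16 * sqrt lam)\<^sup>2" using lam by (simp add: power_mult_distrib)
  finally have "M \<le> 16 * sqrt lam" by (rule power2_le_imp_le) (use lam in simp)
  then have "lip \<le> 4 * sqrt lam * (16 * sqrt lam)"
    unfolding lip_def using lam by (intro mult_left_mono) auto
  then show ?thesis using lam by simp
qed

section \<open>Existence of the normal derivative\<close>

text \<open>The harmonic function \<open>2 \<beta> + \<alpha>\<^sup>2 - \<beta>\<^sup>2\<close> is at least 1 on the lateral and upper sides of the box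
  \<open>\<bar>\<alpha>\<bar> \<le> 1\<close>, \<open>0 \<le> \<beta> \<le> 1\<close> and small near the origin; the last summand absorbs the right-hand side of the
  equation.\<close>

lemma tangential_difference:
  assumes n: "norm n = 1" and supp: "\<And>y. y \<in> \<Omega> \<Longrightarrow> (y - x) \<bullet> n \<ge> 0"
    and S: "S > 0" and h: "\<bar>h\<bar> \<le> S" and \<eta>: "\<eta> \<ge> 0"
    and flat: "\<And>z. z \<in> frontier \<Omega> \<Longrightarrow> \<bar>(z - x) \<bullet> perp n\<bar> \<le> 2 * S \<Longrightarrow> (z - x) \<bullet> n \<le> S \<Longrightarrow> (z - x) \<bullet> n \<le> \<eta>"
    and z: "z \<in> closure \<Omega>" "z + h *\<^sub>R perp n \<in> closure \<Omega>" "\<bar>(z - x) \<bullet> perp n\<bar> \<le> S" "(z - x) \<bullet> n \<le> S"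
  shows "u (z + h *\<^sub>R perp n) - u z \<le> lip * \<eta>
    + lip * \<bar>h\<bar> * (2 * (((z - x) \<bullet> n) / S) + (((z - x) \<bullet> perp n) / S)\<^sup>2 - (((z - x) \<bullet> n) / S)\<^sup>2)
    + 2 * (lam * M) * (S * ((z - x) \<bullet> n) - ((z - x) \<bullet> n)\<^sup>2)"
proof -
  define e where "e = perp n"
  define a where "a z = (z - x) \<bullet> e" for z
  define b where "b z = (z - x) \<bullet> n" for z
  define c where "c = lip * \<bar>h\<bar>"
  define \<kappa> where "\<kappa> = lam * M"
  define g where "g z = u (z + h *\<^sub>R e) - u z" for z
  define H where "H z = lip * \<eta> + c * (2 * (b z / S) + (a z / S)\<^sup>2 - (b z / S)\<^sup>2) + 2 * \<kappa> * (S * b z - (b z)\<^sup>2)" for z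
  have e: "norm e = 1" "n \<bullet> e = 0" "e \<bullet> n = 0" "n \<bullet> n = 1" "e \<bullet> e = 1"
    using n by (auto simp: e_def dot_square_norm)
  have ab: "a (z + t *\<^sub>R n) = a z" "b (z + t *\<^sub>R n) = b z + t" "a (z + t *\<^sub>R e) = a z + t" "b (z + t *\<^sub>R e) = b z" for z t
    using e by (auto simp: a_def b_def inner_add_left inner_diff_left)
  have lip0: "lip > 0" using lam M_pos by (simp add: lip_def)
  have c0: "c \<ge> 0" using lip0 by (simp add: c_def)
  have k0: "\<kappa> > 0" using lam M_pos by (simp add: \<kappa>_def)
  \<comment> \<open>The box is cut down to the points for which the translate also lies in the
    closure, so that \<open>g\<close> can be compared there.\<close>
  let ?K = "closure \<Omega> \<inter> (\<lambda>z. z + h *\<^sub>R e) -` closure \<Omega> \<inter> {z. \<bar>a z\<bar> \<le> S} \<inter> {z. b z \<le> S}"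
  have "g z \<le> H z"
  proof (rule quadratic_comparison[where K = ?K and ?v1.0 = n and ?v2.0 = e
        and ?q1.0 = "\<lambda>z. c * (2 / S - 2 * b z / S\<^sup>2) + 2 * \<kappa> * (S - 2 * b z)" and ?s1.0 = "- (c / S\<^sup>2) - 2 * \<kappa>"
        and ?q2.0 = "\<lambda>z. c * (2 * a z / S\<^sup>2)" and ?s2.0 = "c / S\<^sup>2"])
    show "compact ?K"
      unfolding a_def b_def
      by (intro compact_Int_closed compact_closure_dom closed_Collect_le closed_vimage continuous_intros) auto
    show "continuous_on ?K g"
      unfolding g_def
      by (intro continuous_intros continuous_on_compose2[OF cont]) auto
    show "continuous_on ?K H"
      unfolding H_def a_def b_def by (intro continuous_intros) (use S in auto)
    show "z \<in> ?K" using z by (auto simp: a_def b_def e_def)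
    show "H (z + t *\<^sub>R n) = H z + (c * (2 / S - 2 * b z / S\<^sup>2) + 2 * \<kappa> * (S - 2 * b z)) * t + (- (c / S\<^sup>2) - 2 * \<kappa>) * t\<^sup>2" for z t
      using S by (simp add: H_def ab field_simps power2_eq_square)
    show "H (z + t *\<^sub>R e) = H z + c * (2 * a z / S\<^sup>2) * t + c / S\<^sup>2 * t\<^sup>2" for z t
      using S by (simp add: H_def ab field_simps power2_eq_square)
    fix p assume p: "p \<in> ?K" "g p > H p"
    define q where "q = p + h *\<^sub>R e"
    define T where "T = 2 * (b p / S) + (a p / S)\<^sup>2 - (b p / S)\<^sup>2"
    have pq: "p \<in> closure \<Omega>" "q \<in> closure \<Omega>" "\<bar>a p\<bar> \<le> S" "b p \<le> S" "b q = b p" "\<bar>a q\<bar> \<le> 2 * S"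
      using p h by (auto simp: q_def ab)
    have b0: "b p \<ge> 0" unfolding b_def by (rule support_closure[OF supp pq(1)])
    have bS: "0 \<le> b p / S" "b p / S \<le> 1" using b0 pq S by auto
    have T: "T = (b p / S) * (1 + (1 - b p / S)) + (a p / S)\<^sup>2"
      by (simp add: T_def power2_eq_square algebra_simps)
    moreover have "(b p / S) * (1 + (1 - b p / S)) \<ge> 0"
      by (intro mult_nonneg_nonneg) (use bS in linarith)+
    ultimately have Ta: "T \<ge> (a p / S)\<^sup>2" by linarith
    then have T0: "T \<ge> 0" by (rule order_trans[rotated]) simp
    have par: "S * b p - (b p)\<^sup>2 \<ge> 0"
      using b0 pq mult_nonneg_nonneg[of "b p" "S - b p"] by (simp add: power2_eq_square algebra_simps)
    have kpar: "2 * \<kappa> * (S * b p - (b p)\<^sup>2) \<ge> 0" using par k0 by simp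
    have Heq: "H p = lip * \<eta> + c * T + 2 * \<kappa> * (S * b p - (b p)\<^sup>2)" by (simp add: H_def T_def)
    have "c * T \<ge> 0" using c0 T0 by simp
    then have H1: "H p \<ge> lip * \<eta>" using kpar Heq by simp
    have H2: "H p \<ge> c * T" using kpar Heq lip0 \<eta> by simp
    have "g p \<le> lip * norm (q - p)"
      using lipschitz[OF pq(2,1)] by (simp add: g_def q_def)
    then have gc: "g p \<le> c" using e by (simp add: q_def c_def)
    \<comment> \<open>The Lipschitz bound gives \<open>g p\<close> \<le> \<open>c\<close>, whereas
      \<open>T\<close> is at least 1 on the lateral and upper sides; a violation therefore cannot
      occur there.\<close>
    then have "T < 1" using H2 p(2) c0 mult_left_mono[of 1 T c] by (cases "T \<ge> 1") auto
    \<comment> \<open>If \<open>p\<close> is a boundary point, flatness puts it at height at most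
      \<eta>. Its translate has the same height, so \<open>abs_le_support\<close> bounds the value
      there by \<open>lip * \<eta>\<close>. The translate of \<open>p\<close> is treated
      symmetrically, which is why flatness is assumed up to \<open>2 * S\<close>.\<close>
    have pO: "p \<in> \<Omega>"
    proof (rule ccontr)
      assume "p \<notin> \<Omega>"
      then have fr: "p \<in> frontier \<Omega>" using pq open_dom by (simp add: frontier_def interior_open)
      have "b p \<le> \<eta>" using flat[OF fr] pq S by (auto simp: a_def b_def e_def)
      have "g p \<le> lip * b q"
        using zero[OF fr] abs_le_support[OF n supp pq(2)] by (simp add: g_def b_def q_def)
      also have "\<dots> \<le> lip * \<eta>" using \<open>b p \<le> \<eta>\<close> pq lip0 by simp
      finally show False using H1 p by simp
    qed
    have qO: "q \<in> \<Omega>"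
    proof (rule ccontr)
      assume "q \<notin> \<Omega>"
      then have fr: "q \<in> frontier \<Omega>" using pq open_dom by (simp add: frontier_def interior_open)
      have "b q \<le> \<eta>" using flat[OF fr] pq S by (auto simp: a_def b_def e_def)
      have "g p \<le> lip * b p"
        using zero[OF fr] abs_le_support[OF n supp pq(1)] by (simp add: g_def b_def q_def[symmetric])
      also have "\<dots> \<le> lip * \<eta>" using \<open>b q \<le> \<eta>\<close> pq lip0 by simp
      finally show False using H1 p by simp
    qed
    have "\<bar>a p\<bar> \<noteq> S"
    proof
      assume "\<bar>a p\<bar> = S"
      then have "(a p / S)\<^sup>2 = 1" using S by (simp add: power2_eq_1_iff) (auto simp: abs_if split: if_splits)
      then show False using Ta \<open>T < 1\<close> by simp
    qed
    moreover have "b p \<noteq> S"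
    proof
      assume "b p = S"
      then have "T = 1 + (a p / S)\<^sup>2" using S by (simp add: T_def)
      then show False using \<open>T < 1\<close> by simp
    qed
    ultimately have "p \<in> \<Omega> \<inter> (\<lambda>z. z + h *\<^sub>R e) -` \<Omega> \<inter> {z. \<bar>a z\<bar> < S} \<inter> {z. b z < S}"
      using pO qO pq by (auto simp: q_def)
    then have int: "p \<in> interior ?K"
    proof (rule interiorI[rotated])
      show "open (\<Omega> \<inter> (\<lambda>z. z + h *\<^sub>R e) -` \<Omega> \<inter> {z. \<bar>a z\<bar> < S} \<inter> {z. b z < S})"
        unfolding a_def b_def
        by (intro open_Int open_dom open_Collect_less open_vimage continuous_intros)
    qed (use closure_subset in fastforce)
    obtain a1 b1 where 1: "second_deriv0 (\<lambda>t. u (p + t *\<^sub>R n)) a1"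
      "second_deriv0 (\<lambda>t. u (p + t *\<^sub>R e)) b1" "a1 + b1 = - lam * u p"
      using pde[OF pO n] unfolding e_def by blast
    obtain a2 b2 where 2: "second_deriv0 (\<lambda>t. u (q + t *\<^sub>R n)) a2"
      "second_deriv0 (\<lambda>t. u (q + t *\<^sub>R e)) b2" "a2 + b2 = - lam * u q"
      using pde[OF qO n] unfolding e_def by blast
    have "second_deriv0 (\<lambda>t. g (p + t *\<^sub>R n)) (a2 - a1)" "second_deriv0 (\<lambda>t. g (p + t *\<^sub>R e)) (b2 - b1)"
      using second_deriv0_diff[OF 2(1) 1(1)] second_deriv0_diff[OF 2(2) 1(2)]
      by (simp_all add: g_def q_def add_ac)
    moreover have "a2 - a1 + (b2 - b1) > 2 * (- (c / S\<^sup>2) - 2 * \<kappa> + c / S\<^sup>2)"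
    proof -
      have "lam * (u q - u p) \<le> lam * (2 * M)"
        using M[OF pq(1)] M[OF pq(2)] lam by (intro mult_left_mono) auto
      then show ?thesis using 1(3) 2(3) k0 by (simp add: algebra_simps \<kappa>_def)
    qed
    ultimately show "p \<in> interior ?K \<and> (\<exists>a b. second_deriv0 (\<lambda>t. g (p + t *\<^sub>R n)) a \<and>
           second_deriv0 (\<lambda>t. g (p + t *\<^sub>R e)) b \<and> a + b > 2 * (- (c / S\<^sup>2) - 2 * \<kappa> + c / S\<^sup>2))"
      using int by blast
  qed
  then show ?thesis
    by (simp add: g_def H_def a_def b_def c_def e_def \<kappa>_def)
qed

text \<open>The factor \<open>lip * r / R\<^sup>2\<close> makes the barrier at least
  \<open>lip * r\<close> on the lateral sides, where \<open>abs_le_support\<close> bounds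
  \<open>u\<close>. At height \<open>r\<close> the term with \<open>m\<close> takes over. The middle
  term is harmonic, and the last one has Laplacian \<open>- 2 * lam * M\<close>, below that of
  \<open>u\<close>.\<close>

lemma box_comparison:
  assumes n: "norm n = 1" and supp: "\<And>y. y \<in> \<Omega> \<Longrightarrow> (y - x) \<bullet> n \<ge> 0"
    and r: "r > 0" and R: "R > 0" and m: "m \<ge> 0"
    and top: "\<And>z. z \<in> closure \<Omega> \<Longrightarrow> \<bar>(z - x) \<bullet> perp n\<bar> \<le> R \<Longrightarrow> (z - x) \<bullet> n = r \<Longrightarrow> u z \<le> m * r"
    and z: "z \<in> closure \<Omega>" "\<bar>(z - x) \<bullet> perp n\<bar> \<le> R" "(z - x) \<bullet> n \<le> r"
  shows "u z \<le> m * ((z - x) \<bullet> n)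
    + lip * r / R\<^sup>2 * (((z - x) \<bullet> perp n)\<^sup>2 + r * ((z - x) \<bullet> n) - ((z - x) \<bullet> n)\<^sup>2)
    + lam * M * (r * ((z - x) \<bullet> n) - ((z - x) \<bullet> n)\<^sup>2)"
proof -
  define e where "e = perp n"
  define a where "a z = (z - x) \<bullet> e" for z
  define b where "b z = (z - x) \<bullet> n" for z
  define c where "c = lip * r / R\<^sup>2"
  define \<kappa> where "\<kappa> = lam * M"
  define H where "H z = m * b z + c * ((a z)\<^sup>2 + r * b z - (b z)\<^sup>2) + \<kappa> * (r * b z - (b z)\<^sup>2)" for z
  have e: "norm e = 1" "n \<bullet> e = 0" "e \<bullet> n = 0" "n \<bullet> n = 1" "e \<bullet> e = 1"
    using n by (auto simp: e_def dot_square_norm)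
  have ab: "a (z + t *\<^sub>R n) = a z" "b (z + t *\<^sub>R n) = b z + t" "a (z + t *\<^sub>R e) = a z + t" "b (z + t *\<^sub>R e) = b z" for z t
    using e by (auto simp: a_def b_def inner_add_left inner_diff_left)
  have lip0: "lip > 0" using lam M_pos by (simp add: lip_def)
  have c0: "c \<ge> 0" using lip0 r by (simp add: c_def)
  have k0: "\<kappa> > 0" using lam M_pos by (simp add: \<kappa>_def)
  let ?K = "closure \<Omega> \<inter> {z. \<bar>a z\<bar> \<le> R} \<inter> {z. b z \<le> r}"
  have "u z \<le> H z"
  proof (rule quadratic_comparison[where K = ?K and ?v1.0 = n and ?v2.0 = e
        and ?q1.0 = "\<lambda>z. m + c * (r - 2 * b z) + \<kappa> * (r - 2 * b z)" and ?s1.0 = "- c - \<kappa>"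
        and ?q2.0 = "\<lambda>z. c * (2 * a z)" and ?s2.0 = c])
    show "compact ?K"
      unfolding a_def b_def
      by (intro compact_Int_closed compact_closure_dom closed_Collect_le continuous_intros)
    show "continuous_on ?K u" by (rule continuous_on_subset[OF cont]) auto
    show "continuous_on ?K H"
      unfolding H_def a_def b_def by (intro continuous_intros)
    show "z \<in> ?K" using z by (auto simp: a_def b_def e_def)
    show "H (z + t *\<^sub>R n) = H z + (m + c * (r - 2 * b z) + \<kappa> * (r - 2 * b z)) * t + (- c - \<kappa>) * t\<^sup>2" for z t
      by (simp add: H_def ab algebra_simps power2_eq_square)
    show "H (z + t *\<^sub>R e) = H z + c * (2 * a z) * t + c * t\<^sup>2" for z t
      by (simp add: H_def ab algebra_simps power2_eq_square)
    fix p assume p: "p \<in> ?K" "u p > H p"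
    have pc: "p \<in> closure \<Omega>" "\<bar>a p\<bar> \<le> R" "b p \<le> r" using p by auto
    have b0: "b p \<ge> 0" unfolding b_def by (rule support_closure[OF supp pc(1)])
    have par: "r * b p - (b p)\<^sup>2 \<ge> 0"
      using b0 pc mult_nonneg_nonneg[of "b p" "r - b p"] by (simp add: power2_eq_square algebra_simps)
    have mb: "m * b p \<ge> 0" using m b0 by simp
    have kpar: "\<kappa> * (r * b p - (b p)\<^sup>2) \<ge> 0" "c * (r * b p - (b p)\<^sup>2) \<ge> 0" using par k0 c0 by auto
    have Heq: "H p = m * b p + c * (a p)\<^sup>2 + c * (r * b p - (b p)\<^sup>2) + \<kappa> * (r * b p - (b p)\<^sup>2)"
      by (simp add: H_def algebra_simps)
    have ca: "c * (a p)\<^sup>2 \<ge> 0" using c0 by simp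
    have up: "u p > 0" using Heq mb kpar ca p by linarith
    then have pO: "p \<in> \<Omega>" using in_dom pc by auto
    have "\<bar>a p\<bar> \<noteq> R"
    proof
      assume "\<bar>a p\<bar> = R"
      then have "(a p)\<^sup>2 = R\<^sup>2" by (metis power2_abs)
      then have "c * (a p)\<^sup>2 = lip * r" using R by (simp add: c_def)
      moreover have "u p \<le> lip * b p"
        using abs_le_support[OF n supp pc(1)] by (simp add: b_def)
      moreover have "lip * b p \<le> lip * r" using pc lip0 by simp
      ultimately show False using Heq mb kpar p by linarith
    qed
    moreover have "b p \<noteq> r"
    proof
      assume "b p = r"
      then have "u p \<le> m * b p" using top[of p] pc by (auto simp: a_def b_def e_def)
      then show False using Heq ca kpar p by linarith
    qed
    ultimately have "p \<in> \<Omega> \<inter> {z. \<bar>a z\<bar> < R} \<inter> {z. b z < r}"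
      using pO pc by auto
    then have int: "p \<in> interior ?K"
    proof (rule interiorI[rotated])
      show "open (\<Omega> \<inter> {z. \<bar>a z\<bar> < R} \<inter> {z. b z < r})"
        unfolding a_def b_def
        by (intro open_Int open_dom open_Collect_less continuous_intros)
    qed (use closure_subset in fastforce)
    have "lam * u p \<le> \<kappa>" using M[OF pc(1)] lam by (simp add: \<kappa>_def)
    then have *: "- lam * u p > 2 * (- c - \<kappa> + c)" using k0 by simp
    show "p \<in> interior ?K \<and> (\<exists>a b. second_deriv0 (\<lambda>t. u (p + t *\<^sub>R n)) a \<and>
           second_deriv0 (\<lambda>t. u (p + t *\<^sub>R e)) b \<and> a + b > 2 * (- c - \<kappa> + c))"
      using int pde[OF pO n] * unfolding e_def by metis
  qed
  then show ?thesis
    by (simp add: H_def a_def b_def c_def e_def \<kappa>_def)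
qed

text \<open>The scales are \<open>r < R = k r < S = k\<^sup>2 r\<close> with flatness \<open>1/k\<^sup>3\<close> at scale \<open>S\<close>: then each of the errors,
  divided by \<open>r\<close>, is \<open>O(1/k)\<close> as \<open>r\<close> tends to 0.\<close>

lemma radial_almost_monotone:
  assumes n: "norm n = 1" and supp: "\<And>y. y \<in> \<Omega> \<Longrightarrow> (y - x) \<bullet> n \<ge> 0"
    and flat: "\<And>\<delta>. \<delta> > 0 \<Longrightarrow> \<exists>\<rho>>0. \<forall>s\<in>{0<..\<rho>}. \<forall>z\<in>frontier \<Omega>.
      \<bar>(z - x) \<bullet> perp n\<bar> \<le> s \<longrightarrow> (z - x) \<bullet> n \<le> s \<longrightarrow> (z - x) \<bullet> n \<le> \<delta> * s"
    and inside: "\<forall>s\<in>{0<..t0}. x + s *\<^sub>R n \<in> \<Omega>" and t0: "t0 > 0"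
    and \<epsilon>: "\<epsilon> > 0"
  shows "\<exists>r0>0. \<forall>s r. 0 < s \<and> s \<le> r \<and> r \<le> r0 \<longrightarrow>
    max 0 (u (x + s *\<^sub>R n) / s) \<le> max 0 (u (x + r *\<^sub>R n) / r) + \<epsilon>"
proof -
  have lip0: "lip > 0" using lam M_pos by (simp add: lip_def)
  define \<kappa> where "\<kappa> = lam * M"
  have k0: "\<kappa> > 0" using lam M_pos by (simp add: \<kappa>_def)
  \<comment> \<open>Half of the tolerance is reserved for the errors of order
    \<open>lip / k\<close>, which add up to \<open>5 * lip / k\<close>.\<close>
  define k where "k = max 1 (10 * lip / \<epsilon>)"
  have k1: "k \<ge> 1" by (simp add: k_def)
  have "10 * lip / \<epsilon> \<le> k" by (simp add: k_def)
  then have k: "5 * lip / k \<le> \<epsilon> / 2" using k1 \<epsilon> by (simp add: field_simps)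
  obtain \<rho> where \<rho>: "\<rho> > 0" "\<And>s z. 0 < s \<Longrightarrow> s \<le> \<rho> \<Longrightarrow> z \<in> frontier \<Omega> \<Longrightarrow>
      \<bar>(z - x) \<bullet> perp n\<bar> \<le> s \<Longrightarrow> (z - x) \<bullet> n \<le> s \<Longrightarrow> (z - x) \<bullet> n \<le> 1 / k ^ 3 * s"
    using flat[of "1 / k ^ 3"] k1 by fastforce
  \<comment> \<open>The second bound ensures \<open>2 * S\<close> \<le> \<rho>, so flatness holds at
    the scale that translated points need. The third keeps the error
    \<open>3 * \<kappa> * k\<^sup>2 * r\<close> from the equation below the other half of the
    tolerance.\<close>
  define r0 where "r0 = min t0 (min (\<rho> / (2 * k\<^sup>2)) (\<epsilon> / (6 * \<kappa> * k\<^sup>2)))"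
  have r0: "r0 > 0" using t0 \<rho> k0 k1 \<epsilon> by (simp add: r0_def)
  show ?thesis
  proof (intro exI[of _ r0] conjI allI impI r0)
    fix s r assume "0 < s \<and> s \<le> r \<and> r \<le> r0"
    then have s: "0 < s" "s \<le> r" and r: "0 < r" "r \<le> t0" "r \<le> \<rho> / (2 * k\<^sup>2)" "r \<le> \<epsilon> / (6 * \<kappa> * k\<^sup>2)"
      by (auto simp: r0_def)
    have kk: "k\<^sup>2 \<ge> k" "k\<^sup>2 \<ge> 1" using k1 by (auto intro: self_le_power one_le_power)
    define R where "R = k * r"
    define S where "S = k\<^sup>2 * r"
    have R: "R > 0" and S: "S > 0" "2 * S \<le> \<rho>" and RS: "R \<le> S" "r \<le> S"
      using r k1 kk by (auto simp: R_def S_def field_simps)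
    have err: "3 * \<kappa> * k\<^sup>2 * r \<le> \<epsilon> / 2" using r(4) k0 k1 by (simp add: field_simps)
    have dot: "n \<bullet> n = 1" "perp n \<bullet> perp n = 1" using n by (auto simp: dot_square_norm)
    let ?x = "\<lambda>s. x + s *\<^sub>R n"
    have in_c: "?x s' \<in> closure \<Omega>" if "0 < s'" "s' \<le> r" for s'
    proof -
      have "s' \<in> {0<..t0}" using that r by auto
      then show ?thesis using inside closure_subset by blast
    qed
    \<comment> \<open>A bound for \<open>u / r\<close> on the whole top side: the value on the
      normal plus the tangential variation. Flatness and the harmonic term of
      \<open>tangential_difference\<close> contribute \<open>2 * lip / k\<close> each; the last
      summand comes from the equation.\<close>
    define m where "m = max 0 (u (?x r) / r) + 4 * lip / k + 2 * \<kappa> * k\<^sup>2 * r"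
    have m0: "m \<ge> 0" using lip0 k1 k0 r by (simp add: m_def)
    have top: "u z \<le> m * r"
      if z: "z \<in> closure \<Omega>" "\<bar>(z - x) \<bullet> perp n\<bar> \<le> R" "(z - x) \<bullet> n = r" for z
    proof -
      define h where "h = (z - x) \<bullet> perp n"
      have hR: "\<bar>h\<bar> \<le> R" using z by (simp add: h_def)
      have zh: "?x r + h *\<^sub>R perp n = z"
        using perp_expansion[OF n, of "z - x"] z(3) by (simp add: h_def algebra_simps)
      have "u (?x r + h *\<^sub>R perp n) - u (?x r) \<le> lip * (1 / k ^ 3 * (2 * S)) +
          lip * \<bar>h\<bar> * (2 * (((?x r - x) \<bullet> n) / S) + (((?x r - x) \<bullet> perp n) / S)\<^sup>2 - (((?x r - x) \<bullet> n) / S)\<^sup>2)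
          + 2 * (lam * M) * (S * ((?x r - x) \<bullet> n) - ((?x r - x) \<bullet> n)\<^sup>2)"
      proof (rule tangential_difference[OF n supp S(1)])
        show "\<bar>h\<bar> \<le> S" using hR RS by simp
        show "1 / k ^ 3 * (2 * S) \<ge> 0" using k1 S by simp
        show "?x r \<in> closure \<Omega>" using in_c r by simp
        show "?x r + h *\<^sub>R perp n \<in> closure \<Omega>" using zh z by simp
        show "(y - x) \<bullet> n \<le> 1 / k ^ 3 * (2 * S)"
          if "y \<in> frontier \<Omega>" "\<bar>(y - x) \<bullet> perp n\<bar> \<le> 2 * S" "(y - x) \<bullet> n \<le> S" for y
          by (rule \<rho>(2)) (use that S in auto)
      qed (use S RS dot in auto)
      also have "\<dots> = lip * (1 / k ^ 3 * (2 * S)) + lip * \<bar>h\<bar> * (2 * (r / S) - (r / S)\<^sup>2) + 2 * \<kappa> * (S * r - r\<^sup>2)"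
        using dot by (simp add: \<kappa>_def)
      also have "\<dots> \<le> lip * (1 / k ^ 3 * (2 * S)) + lip * R * (2 * (r / S)) + 2 * \<kappa> * (S * r)"
      proof (intro add_mono order_refl)
        have "lip * \<bar>h\<bar> * (2 * (r / S) - (r / S)\<^sup>2) \<le> lip * \<bar>h\<bar> * (2 * (r / S))"
          using lip0 by (intro mult_left_mono) auto
        also have "\<dots> \<le> lip * R * (2 * (r / S))"
          using lip0 hR r S by (intro mult_right_mono mult_left_mono) auto
        finally show "lip * \<bar>h\<bar> * (2 * (r / S) - (r / S)\<^sup>2) \<le> lip * R * (2 * (r / S))" .
        show "2 * \<kappa> * (S * r - r\<^sup>2) \<le> 2 * \<kappa> * (S * r)" using k0 by (intro mult_left_mono) auto
      qed
      also have "\<dots> = (4 * lip / k + 2 * \<kappa> * k\<^sup>2 * r) * r"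
        using k1 r by (simp add: R_def S_def field_simps power2_eq_square power3_eq_cube)
      finally have "u z \<le> u (?x r) + (4 * lip / k + 2 * \<kappa> * k\<^sup>2 * r) * r" unfolding zh by simp
      also have "u (?x r) \<le> max 0 (u (?x r) / r) * r" using r by (simp add: max_def field_simps)
      finally show ?thesis by (simp add: m_def algebra_simps)
    qed
    have "u (?x s) \<le> m * ((?x s - x) \<bullet> n)
      + lip * r / R\<^sup>2 * (((?x s - x) \<bullet> perp n)\<^sup>2 + r * ((?x s - x) \<bullet> n) - ((?x s - x) \<bullet> n)\<^sup>2)
      + lam * M * (r * ((?x s - x) \<bullet> n) - ((?x s - x) \<bullet> n)\<^sup>2)"
    proof (rule box_comparison[OF n supp r(1) R m0 top])
      show "?x s \<in> closure \<Omega>" using in_c s by simp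
    qed (use dot s R in auto)
    also have "\<dots> = m * s + lip * r / R\<^sup>2 * (r * s - s\<^sup>2) + \<kappa> * (r * s - s\<^sup>2)"
      using dot by (simp add: \<kappa>_def)
    also have "\<dots> \<le> m * s + lip * r / R\<^sup>2 * (r * s) + \<kappa> * (r * s)"
      using lip0 r k0 by (intro add_mono mult_left_mono order_refl) auto
    also have "\<dots> = (m + lip / k\<^sup>2 + \<kappa> * r) * s"
      using r k1 by (simp add: R_def power2_eq_square field_simps)
    also have "\<dots> \<le> (m + lip / k + \<kappa> * k\<^sup>2 * r) * s"
      using kk k1 lip0 k0 r s by (intro mult_right_mono add_mono order_refl) (auto intro!: divide_left_mono)
    finally have "u (?x s) / s \<le> m + lip / k + \<kappa> * k\<^sup>2 * r" using s by (simp add: divide_le_eq)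
    also have "\<dots> = max 0 (u (?x r) / r) + 5 * lip / k + 3 * \<kappa> * k\<^sup>2 * r"
      by (simp add: m_def)
    also have "\<dots> \<le> max 0 (u (?x r) / r) + \<epsilon>" using k err by simp
    finally show "max 0 (u (?x s) / s) \<le> max 0 (u (?x r) / r) + \<epsilon>" using \<epsilon> by simp
  qed
qed

end

text \<open>The limit is the supremum of \<open>A\<close>, that is, the limit inferior at 0. A
  radius \<open>r\<close> where \<open>q r\<close> is close to it bounds \<open>q\<close> from above
  at all smaller radii, by almost monotonicity.\<close>

lemma tendsto_at_right_if_almost_decreasing:
  fixes q :: "real \<Rightarrow> real"
  assumes t0: "t0 > 0" and bd: "\<And>s. 0 < s \<Longrightarrow> s \<le> t0 \<Longrightarrow> 0 \<le> q s \<and> q s \<le> B"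
    and mono: "\<And>\<epsilon>. \<epsilon> > 0 \<Longrightarrow> \<exists>r0>0. \<forall>s r. 0 < s \<and> s \<le> r \<and> r \<le> r0 \<longrightarrow> q s \<le> q r + \<epsilon>"
  shows "\<exists>l. (q \<longlongrightarrow> l) (at_right 0)"
proof -
  define A where "A = {c. \<exists>\<rho>>0. \<forall>s. 0 < s \<and> s \<le> \<rho> \<longrightarrow> c \<le> q s}"
  have A0: "0 \<in> A" using t0 bd by (auto simp: A_def)
  have AB: "c \<le> B" if c: "c \<in> A" for c
  proof -
    obtain \<rho> where \<rho>: "\<rho> > 0" "\<And>s. 0 < s \<Longrightarrow> s \<le> \<rho> \<Longrightarrow> c \<le> q s"
      using c unfolding A_def by blast
    have "c \<le> q (min \<rho> t0)" using \<rho> t0 by auto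
    also have "\<dots> \<le> B" using bd \<rho> t0 by auto
    finally show ?thesis .
  qed
  have bdd: "bdd_above A" using AB by (auto simp: bdd_above_def)
  have "(q \<longlongrightarrow> Sup A) (at_right 0)"
  proof (rule tendstoI)
    fix \<epsilon> :: real assume \<epsilon>: "\<epsilon> > 0"
    obtain c where c: "c \<in> A" "Sup A - \<epsilon> < c"
      using less_cSup_iff[of A "Sup A - \<epsilon>"] A0 bdd \<epsilon> by auto
    obtain \<rho> where \<rho>: "\<rho> > 0" "\<And>s. 0 < s \<Longrightarrow> s \<le> \<rho> \<Longrightarrow> c \<le> q s"
      using c(1) unfolding A_def by blast
    obtain r0 where r0: "r0 > 0" "\<And>s r. 0 < s \<Longrightarrow> s \<le> r \<Longrightarrow> r \<le> r0 \<Longrightarrow> q s \<le> q r + \<epsilon> / 2"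
      using mono[of "\<epsilon> / 2"] \<epsilon> by auto
    have "Sup A + \<epsilon> / 2 \<notin> A" using cSup_upper[OF _ bdd] \<epsilon> by force
    then obtain r where r: "0 < r" "r \<le> r0" "q r < Sup A + \<epsilon> / 2"
      using r0(1) by (auto simp: A_def not_le)
    show "\<forall>\<^sub>F s in at_right 0. dist (q s) (Sup A) < \<epsilon>"
      unfolding eventually_at_right_field
    proof (intro exI[of _ "min \<rho> r"] conjI allI impI)
      fix s assume s: "0 < s" "s < min \<rho> r"
      have "c \<le> q s" using \<rho>(2)[of s] s by simp
      moreover have "q s \<le> q r + \<epsilon> / 2" using r0(2)[of s r] s r by simp
      ultimately show "dist (q s) (Sup A) < \<epsilon>" using c r by (simp add: dist_real_def abs_less_iff)
    qed (use \<rho> r in auto)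
  qed
  then show ?thesis by blast
qed

section \<open>Convex geometry at a boundary point with a unique normal\<close>

text \<open>A ray missing the domain could be separated from it. The separating normal would be a
  supporting normal at \<open>x\<close>, hence a positive multiple of \<open>n\<close>, yet have
  nonpositive inner product with \<open>w\<close>.\<close>

lemma convex_contains_inward_rays:
  fixes \<Omega> :: "'a::euclidean_space set"
  assumes \<Omega>: "open \<Omega>" "convex \<Omega>" "\<Omega> \<noteq> {}" and x: "x \<in> frontier \<Omega>"
    and uniq: "\<And>v. norm v = 1 \<Longrightarrow> (\<And>y. y \<in> \<Omega> \<Longrightarrow> (y - x) \<bullet> v \<ge> 0) \<Longrightarrow> v = n"
    and w: "w \<bullet> n > 0"
  shows "\<exists>t0>0. \<forall>t\<in>{0<..t0}. x + t *\<^sub>R w \<in> \<Omega>"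
proof -
  have xn: "x \<notin> \<Omega>" and xc: "x \<in> closure \<Omega>" using x \<Omega> by (auto simp: frontier_def interior_open)
  have "\<exists>t\<ge>0. x + t *\<^sub>R w \<in> \<Omega>"
  proof (rule ccontr)
    assume none: "\<not> (\<exists>t\<ge>0. x + t *\<^sub>R w \<in> \<Omega>)"
    define A where "A = (\<lambda>t. x + t *\<^sub>R w) ` {0..}"
    have "convex A"
    proof -
      have "A = (+) x ` ((\<lambda>t. t *\<^sub>R w) ` {0..})" by (auto simp: A_def)
      then show ?thesis
        by (simp add: convex_translation convex_linear_image linear_scale_left)
    qed
    moreover have "A \<inter> \<Omega> = {}" using none by (auto simp: A_def)
    moreover have "A \<noteq> {}" by (simp add: A_def)
    ultimately obtain a b where ab: "a \<noteq> 0" "\<And>p. p \<in> A \<Longrightarrow> a \<bullet> p \<le> b" "\<And>y. y \<in> \<Omega> \<Longrightarrow> a \<bullet> y \<ge> b"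
      using separating_hyperplane_sets[of A \<Omega>] \<Omega> by blast
    have ray: "a \<bullet> x + t * (a \<bullet> w) \<le> b" if "t \<ge> 0" for t
      using ab(2)[of "x + t *\<^sub>R w"] that by (auto simp: A_def inner_add_right)
    have "closed {y. a \<bullet> y \<ge> b}" by (simp add: closed_halfspace_ge)
    then have "closure \<Omega> \<subseteq> {y. a \<bullet> y \<ge> b}"
      by (intro closure_minimal) (use ab in auto)
    then have "a \<bullet> x \<ge> b" using xc by auto
    with ray[of 1] have aw: "a \<bullet> w \<le> 0" by simp
    have "a /\<^sub>R norm a = n"
    proof (rule uniq)
      fix y assume "y \<in> \<Omega>"
      then have "a \<bullet> (y - x) \<ge> 0" using ab(3)[of y] ray[of 0] by (simp add: inner_diff_right)
      then show "(y - x) \<bullet> (a /\<^sub>R norm a) \<ge> 0" by (simp add: inner_commute)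
    qed (use ab in auto)
    then have "a = norm a *\<^sub>R n" using ab by auto
    then have "a \<bullet> w = norm a * (n \<bullet> w)" by (metis inner_scaleR_left)
    with aw w ab show False by (auto simp: inner_commute mult_le_0_iff)
  qed
  then obtain t1 where t1: "t1 \<ge> 0" "x + t1 *\<^sub>R w \<in> \<Omega>" by blast
  have "t1 \<noteq> 0" using t1 xn by (metis add.right_neutral scaleR_zero_left)
  then have pos: "t1 > 0" using t1 by simp
  \<comment> \<open>Once the ray hits the open convex set at \<open>t1\<close>, the whole segment
    back to the closure point \<open>x\<close>, without \<open>x\<close> itself, lies in it.\<close>
  have "x + t *\<^sub>R w \<in> \<Omega>" if "t \<in> {0<..t1}" for t
  proof -
    have "x - (t / t1) *\<^sub>R (x - (x + t1 *\<^sub>R w)) \<in> interior \<Omega>"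
      by (rule mem_interior_closure_convex_shrink[OF \<Omega>(2)])
         (use t1 that pos xc \<Omega>(1) in \<open>auto simp: interior_open\<close>)
    then show ?thesis using pos \<Omega>(1) by (simp add: interior_open)
  qed
  with pos show ?thesis by blast
qed

text \<open>The two rays with slope \<delta> on either side of \<open>n\<close> start inside the
  domain. By convexity so does the sector between them, and a boundary point above height
  \<open>\<delta> * s\<close> would lie in that sector.\<close>

lemma frontier_flat_at_regular_point:
  fixes \<Omega> :: "(real ^ 2) set"
  assumes \<Omega>: "open \<Omega>" "convex \<Omega>" "\<Omega> \<noteq> {}" and x: "x \<in> frontier \<Omega>" and n: "norm n = 1"
    and uniq: "\<And>v. norm v = 1 \<Longrightarrow> (\<And>y. y \<in> \<Omega> \<Longrightarrow> (y - x) \<bullet> v \<ge> 0) \<Longrightarrow> v = n"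
    and \<delta>: "\<delta> > 0"
  shows "\<exists>\<rho>>0. \<forall>s\<in>{0<..\<rho>}. \<forall>z\<in>frontier \<Omega>.
      \<bar>(z - x) \<bullet> perp n\<bar> \<le> s \<longrightarrow> (z - x) \<bullet> n \<le> s \<longrightarrow> (z - x) \<bullet> n \<le> \<delta> * s"
proof -
  let ?w = "\<lambda>\<theta>. \<theta> *\<^sub>R perp n + \<delta> *\<^sub>R n"
  have w: "?w \<theta> \<bullet> n > 0" for \<theta>
    using n \<delta> by (simp add: inner_add_left dot_square_norm)
  obtain t1 t2 where t: "t1 > 0" "\<forall>t\<in>{0<..t1}. x + t *\<^sub>R ?w 1 \<in> \<Omega>"
      "t2 > 0" "\<forall>t\<in>{0<..t2}. x + t *\<^sub>R ?w (-1) \<in> \<Omega>"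
    using convex_contains_inward_rays[OF \<Omega> x uniq w, of 1]
      convex_contains_inward_rays[OF \<Omega> x uniq w, of "-1"] by blast
  define \<rho> where "\<rho> = \<delta> * min t1 t2"
  show ?thesis
  proof (intro exI[of _ \<rho>] conjI ballI impI)
    fix s z assume s: "s \<in> {0<..\<rho>}" and z: "z \<in> frontier \<Omega>"
      "\<bar>(z - x) \<bullet> perp n\<bar> \<le> s" "(z - x) \<bullet> n \<le> s"
    show "(z - x) \<bullet> n \<le> \<delta> * s"
    proof (rule ccontr)
      assume "\<not> (z - x) \<bullet> n \<le> \<delta> * s"
      then have b: "(z - x) \<bullet> n > \<delta> * s" by simp
      \<comment> \<open>Both rays reach the height of \<open>z\<close> at parameter
        \<open>t\<close>, and \<theta> in [-1, 1] is the position of \<open>z\<close> between them.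
        The choice of \<rho> guarantees \<open>t\<close> \<le> \<open>min t1 t2\<close>.\<close>
      define t where "t = (z - x) \<bullet> n / \<delta>"
      define \<theta> where "\<theta> = (z - x) \<bullet> perp n / t"
      have ts: "t > s" "s > 0" using b \<delta> s by (auto simp: t_def field_simps)
      then have tt: "t > 0" by simp
      have "t \<le> s / \<delta>" using z \<delta> by (simp add: t_def divide_right_mono)
      also have "\<dots> \<le> min t1 t2"
        unfolding pos_divide_le_eq[OF \<delta>] using s by (simp only: \<rho>_def mult.commute greaterThanAtMost_iff)
      finally have tm: "t \<le> min t1 t2" .
      have "\<bar>\<theta>\<bar> = \<bar>(z - x) \<bullet> perp n\<bar> / t" using tt by (simp add: \<theta>_def)
      also have "\<dots> \<le> 1" using z(2) ts tt by (simp add: divide_le_eq)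
      finally have "\<bar>\<theta>\<bar> \<le> 1" .
      then have th: "-1 \<le> \<theta>" "\<theta> \<le> 1" by auto
      have in12: "x + t *\<^sub>R ?w 1 \<in> \<Omega>" "x + t *\<^sub>R ?w (-1) \<in> \<Omega>" using t tt tm by auto
      have coord: "t * \<theta> = (z - x) \<bullet> perp n" "t * \<delta> = (z - x) \<bullet> n"
        using tt \<delta> by (simp add: \<theta>_def, simp add: t_def)
      have "z = x + (((z - x) \<bullet> n) *\<^sub>R n + ((z - x) \<bullet> perp n) *\<^sub>R perp n)"
        using perp_expansion[OF n, of "z - x"] by simp
      also have "\<dots> = x + t *\<^sub>R ?w \<theta>"
        unfolding coord[symmetric] by (simp add: scaleR_add_right add.commute)
      also have "\<dots> = ((1 + \<theta>) / 2) *\<^sub>R (x + t *\<^sub>R ?w 1) + ((1 - \<theta>) / 2) *\<^sub>R (x + t *\<^sub>R ?w (-1))"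
        by (simp add: vec_eq_iff field_simps)
      also have "\<dots> \<in> \<Omega>"
        by (rule convexD[OF \<Omega>(2) in12]) (use th in \<open>auto simp: field_simps\<close>)
      finally show False using z(1) \<Omega>(1) by (simp add: frontier_def interior_open)
    qed
  qed (use t \<delta> in \<open>simp add: \<rho>_def\<close>)
qed

context bounded_membrane
begin

text \<open>The almost monotonicity concerns the quotient truncated at 0, so the positive part and,
  through \<open>-u\<close>, the negative part converge separately; their difference is the quotient
  itself.\<close>

lemma tendsto_radial_quotient:
  assumes x: "x \<in> frontier \<Omega>" and n: "norm n = 1" and supp: "\<And>y. y \<in> \<Omega> \<Longrightarrow> (y - x) \<bullet> n \<ge> 0"
    and uniq: "\<And>v. norm v = 1 \<Longrightarrow> (\<And>y. y \<in> \<Omega> \<Longrightarrow> (y - x) \<bullet> v \<ge> 0) \<Longrightarrow> v = n"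
  obtains t0 l where "t0 > 0" "\<And>s. 0 < s \<Longrightarrow> s \<le> t0 \<Longrightarrow> x + s *\<^sub>R n \<in> \<Omega>"
    "((\<lambda>s. u (x + s *\<^sub>R n) / s) \<longlongrightarrow> l) (at_right 0)" "\<bar>l\<bar> \<le> lip"
proof -
  note \<Omega> = open_dom convex_dom nonempty
  have "n \<bullet> n > 0" using n by (simp add: dot_square_norm)
  from convex_contains_inward_rays[OF \<Omega> x uniq this] obtain t0 where
    t0: "t0 > 0" "\<forall>s\<in>{0<..t0}. x + s *\<^sub>R n \<in> \<Omega>" by blast
  note flat = frontier_flat_at_regular_point[OF \<Omega> x n uniq]
  have bd: "\<bar>u (x + s *\<^sub>R n) / s\<bar> \<le> lip" if s: "0 < s" "s \<le> t0" for s
  proof -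
    have "s \<in> {0<..t0}" using s by simp
    then have "x + s *\<^sub>R n \<in> closure \<Omega>" using t0(2) closure_subset by blast
    moreover have "(x + s *\<^sub>R n - x) \<bullet> n = s" using n by (simp add: dot_square_norm)
    ultimately have "\<bar>u (x + s *\<^sub>R n)\<bar> \<le> lip * s" using abs_le_support[OF n supp] by metis
    then show ?thesis using s by (simp add: divide_le_eq)
  qed
  have lip0: "lip \<ge> 0" using lam M_pos by (simp add: lip_def)
  have bd': "0 \<le> max 0 (c / s) \<and> max 0 (c / s) \<le> lip" if "\<bar>c / s\<bar> \<le> lip" for c s
    using that lip0 by (simp add: abs_le_iff del: abs_divide)
  have "\<exists>l. ((\<lambda>s. max 0 (u (x + s *\<^sub>R n) / s)) \<longlongrightarrow> l) (at_right 0)"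
  proof (rule tendsto_at_right_if_almost_decreasing[OF t0(1)])
    show "0 \<le> max 0 (u (x + s *\<^sub>R n) / s) \<and> max 0 (u (x + s *\<^sub>R n) / s) \<le> lip"
      if "0 < s" "s \<le> t0" for s
      by (rule bd') (use bd[OF that] in simp)
    show "\<exists>r0>0. \<forall>s r. 0 < s \<and> s \<le> r \<and> r \<le> r0 \<longrightarrow>
      max 0 (u (x + s *\<^sub>R n) / s) \<le> max 0 (u (x + r *\<^sub>R n) / r) + \<epsilon>" if "\<epsilon> > 0" for \<epsilon>
      by (rule radial_almost_monotone[OF n supp flat t0(2,1) that])
  qed
  then obtain l1 where l1: "((\<lambda>s. max 0 (u (x + s *\<^sub>R n) / s)) \<longlongrightarrow> l1) (at_right 0)" ..
  have "\<exists>l. ((\<lambda>s. max 0 (- u (x + s *\<^sub>R n) / s)) \<longlongrightarrow> l) (at_right 0)"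
  proof (rule tendsto_at_right_if_almost_decreasing[OF t0(1)])
    show "0 \<le> max 0 (- u (x + s *\<^sub>R n) / s) \<and> max 0 (- u (x + s *\<^sub>R n) / s) \<le> lip"
      if "0 < s" "s \<le> t0" for s
      by (rule bd') (use bd[OF that] in simp)
    show "\<exists>r0>0. \<forall>s r. 0 < s \<and> s \<le> r \<and> r \<le> r0 \<longrightarrow>
      max 0 (- u (x + s *\<^sub>R n) / s) \<le> max 0 (- u (x + r *\<^sub>R n) / r) + \<epsilon>" if "\<epsilon> > 0" for \<epsilon>
      by (rule bounded_membrane.radial_almost_monotone[OF bounded_membrane_minus, OF n supp flat t0(2,1) that])
  qed
  then obtain l2 where l2: "((\<lambda>s. max 0 (- u (x + s *\<^sub>R n) / s)) \<longlongrightarrow> l2) (at_right 0)" ..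
  have "(\<lambda>s. max 0 (u (x + s *\<^sub>R n) / s) - max 0 (- u (x + s *\<^sub>R n) / s)) = (\<lambda>s. u (x + s *\<^sub>R n) / s)"
    by (rule ext) (simp add: max_def)
  with tendsto_diff[OF l1 l2] have l: "((\<lambda>s. u (x + s *\<^sub>R n) / s) \<longlongrightarrow> l1 - l2) (at_right 0)"
    by simp
  have "\<bar>l1 - l2\<bar> \<le> lip"
  proof (rule tendsto_upperbound[OF tendsto_rabs[OF l]])
    show "\<forall>\<^sub>F s in at_right 0. \<bar>u (x + s *\<^sub>R n) / s\<bar> \<le> lip"
      unfolding eventually_at_right_field using t0 bd by (intro exI[of _ t0]) auto
  qed simp
  with l t0 show ?thesis by (intro that[of t0 "l1 - l2"]) auto
qed

end

section \<open>Almost everywhere statements on the boundary\<close>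

lemma countable_irregular_points:
  fixes \<Omega> :: "(real ^ 2) set"
  assumes \<Omega>: "open \<Omega>" "convex \<Omega>" "\<Omega> \<noteq> {}"
  shows "countable {x \<in> frontier \<Omega>. \<nexists>\<nu>. outward_unit_normals \<Omega> x = {\<nu>}}" (is "countable ?I")
proof -
  define N where "N x = {v. \<forall>y\<in>\<Omega>. (y - x) \<bullet> v \<le> 0}" for x
  \<comment> \<open>A normal cone with empty interior lies in a line through 0. Two different unit
    normals on it are opposite, which would squeeze the open domain into a line.\<close>
  have thick: "interior (N x) \<noteq> {}" if x: "x \<in> ?I" for x
  proof
    assume emp: "interior (N x) = {}"
    have "convex (N x)"
      unfolding N_def by (auto intro!: convexI simp: inner_add_right)
        (smt (verit) mult_nonneg_nonpos)
    then obtain a b where ab: "a \<noteq> 0" "N x \<subseteq> {v. a \<bullet> v = b}"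
      using empty_interior_subset_hyperplane[of "N x"] emp by metis
    have "0 \<in> N x" by (simp add: N_def)
    then have b: "b = 0" using ab by auto
    obtain n1 where "norm n1 = 1" "\<And>y. y \<in> \<Omega> \<Longrightarrow> (y - x) \<bullet> n1 \<ge> 0"
      using supporting_normal_exists[OF \<Omega>, of x] x by blast
    then have n1: "- n1 \<in> outward_unit_normals \<Omega> x" by (simp add: outward_unit_normals_def)
    moreover have "outward_unit_normals \<Omega> x \<noteq> {- n1}" using x by blast
    ultimately obtain n2 where n2: "n2 \<in> outward_unit_normals \<Omega> x" "n2 \<noteq> - n1" by blast
    define m where "m = - n1"
    have m: "norm m = 1" "m \<in> N x" "norm n2 = 1" "n2 \<in> N x" "n2 \<noteq> m"
      using n1 n2 by (auto simp: N_def outward_unit_normals_def m_def)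
    define e where "e = a /\<^sub>R norm a"
    have e: "norm e = 1" "m \<bullet> e = 0" "n2 \<bullet> e = 0"
      using ab b m by (auto simp: e_def inner_commute)
    have pm: "m = (m \<bullet> perp e) *\<^sub>R perp e" "n2 = (n2 \<bullet> perp e) *\<^sub>R perp e"
      using perp_expansion[OF e(1), of m] perp_expansion[OF e(1), of n2] e by simp_all
    have "\<bar>m \<bullet> perp e\<bar> = 1" "\<bar>n2 \<bullet> perp e\<bar> = 1"
      using arg_cong[OF pm(1), of norm] arg_cong[OF pm(2), of norm] e(1) m by auto
    then have "n2 \<bullet> perp e = m \<bullet> perp e \<or> n2 \<bullet> perp e = - (m \<bullet> perp e)" by auto
    then have "n2 = - m"
      using pm m(5) by (metis scaleR_minus_left)
    then have "\<Omega> \<subseteq> {y. m \<bullet> y = m \<bullet> x}"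
      using m by (force simp: N_def inner_diff_left inner_diff_right inner_commute)
    then have "interior \<Omega> \<subseteq> interior {y. m \<bullet> y = m \<bullet> x}" by (rule interior_mono)
    moreover have "m \<noteq> 0" using m by auto
    ultimately show False using \<Omega> by (simp add: interior_open)
  qed
  \<comment> \<open>A common normal \<open>v\<close> of two boundary points is orthogonal to their
    difference, so the open intersection lies in a line and is empty. Disjoint nonempty open sets
    are countably many.\<close>
  have disj: "interior (N x) \<inter> interior (N x') = {}" if x: "x \<in> ?I" "x' \<in> ?I" "x \<noteq> x'" for x x'
  proof -
    have cl: "(p - q) \<bullet> v \<le> 0" if "p \<in> ?I" "v \<in> N q" for p q v
    proof -
      have "closed {y. (y - q) \<bullet> v \<le> 0}" by (intro closed_Collect_le continuous_intros)
      then have "closure \<Omega> \<subseteq> {y. (y - q) \<bullet> v \<le> 0}"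
        by (intro closure_minimal) (use that in \<open>auto simp: N_def\<close>)
      then show ?thesis using that by (auto simp: frontier_def)
    qed
    have "interior (N x) \<inter> interior (N x') \<subseteq> {v. (x' - x) \<bullet> v = 0}"
    proof
      fix v assume "v \<in> interior (N x) \<inter> interior (N x')"
      then have "v \<in> N x" "v \<in> N x'" using interior_subset by auto
      with cl[OF x(2), of v x] cl[OF x(1), of v x'] show "v \<in> {v. (x' - x) \<bullet> v = 0}"
        by (simp add: inner_diff_left)
    qed
    then have "interior (interior (N x) \<inter> interior (N x')) \<subseteq> interior {v. (x' - x) \<bullet> v = 0}"
      by (rule interior_mono)
    then show ?thesis using x(3) by simp
  qed
  have inj: "inj_on (\<lambda>x. interior (N x)) ?I"
    by (rule inj_onI) (use thick disj in blast)
  have "countable ((\<lambda>x. interior (N x)) ` ?I)"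
    by (rule countable_disjoint_open_subsets) (use disj in \<open>auto simp: pairwise_def disjnt_def\<close>)
  then show ?thesis using inj by (rule countable_image_inj_on)
qed

section \<open>Measurability of the normal derivative\<close>

text \<open>The conditions defining the normals are closed in the point and the vector jointly, so
  the graph is closed; a closed graph over a compact target, here the unit sphere, means
  continuity.\<close>

lemma continuous_on_unit_normal:
  fixes \<Omega> :: "'a::euclidean_space set"
  assumes R: "\<And>x. x \<in> R \<Longrightarrow> outward_unit_normals \<Omega> x = {\<nu> x}"
  shows "continuous_on R \<nu>"
proof -
  have sph: "\<nu> \<in> R \<rightarrow> sphere 0 1"
  proof
    fix x assume "x \<in> R"
    then have "\<nu> x \<in> outward_unit_normals \<Omega> x" using R by simp
    then show "\<nu> x \<in> sphere 0 1" by (simp add: outward_unit_normals_def)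
  qed
  have "(\<lambda>x. (x, \<nu> x)) ` R = (R \<times> sphere 0 1) \<inter> (\<Inter>y\<in>\<Omega>. {p. (y - fst p) \<bullet> snd p \<le> 0})"
  proof (intro equalityI subsetI)
    fix p assume "p \<in> (R \<times> sphere 0 1) \<inter> (\<Inter>y\<in>\<Omega>. {p. (y - fst p) \<bullet> snd p \<le> 0})"
    then have "fst p \<in> R" "snd p \<in> outward_unit_normals \<Omega> (fst p)"
      by (auto simp: outward_unit_normals_def)
    then have "p = (fst p, \<nu> (fst p))" using R[of "fst p"] by (simp add: prod_eq_iff)
    with \<open>fst p \<in> R\<close> show "p \<in> (\<lambda>x. (x, \<nu> x)) ` R" by (rule rev_image_eqI)
  next
    fix p assume "p \<in> (\<lambda>x. (x, \<nu> x)) ` R"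
    then obtain x where x: "x \<in> R" "p = (x, \<nu> x)" by blast
    then have "\<nu> x \<in> outward_unit_normals \<Omega> x" using R by simp
    with x show "p \<in> (R \<times> sphere 0 1) \<inter> (\<Inter>y\<in>\<Omega>. {p. (y - fst p) \<bullet> snd p \<le> 0})"
      by (auto simp: outward_unit_normals_def)
  qed
  moreover have "closed (\<Inter>y\<in>\<Omega>. {p. (y - fst p) \<bullet> snd p \<le> 0})"
    by (intro closed_INT ballI closed_Collect_le continuous_intros)
  ultimately have "closedin (top_of_set (R \<times> sphere 0 1)) ((\<lambda>x. (x, \<nu> x)) ` R)"
    by (simp add: closedin_closed_Int)
  then show ?thesis by (simp add: continuous_closed_graph_eq[OF compact_sphere sph])
qed

lemma hausdorff1_countable_null:
  assumes "countable (X :: 'a::metric_space set)"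
  shows "X \<in> null_sets hausdorff1"
proof -
  have "{x} \<in> null_sets hausdorff1" for x :: 'a
  proof
    show m: "{x} \<in> sets hausdorff1" by (rule closed_in_sets_hausdorff1) simp
    have "hausdorff1_pre \<delta> {x} = 0" if "\<delta> > 0" for \<delta>
      using hausdorff1_pre_le[of "{x}" "\<lambda>_. {x}" \<delta>] that by auto
    then show "emeasure hausdorff1 {x} = 0"
      unfolding emeasure_hausdorff1[OF m] hausdorff1_outer_def
      by (subst SUP_cong[OF refl, where D = "\<lambda>_. 0"]) auto
  qed
  then have "(\<Union>x\<in>X. {x}) \<in> null_sets hausdorff1"
    by (intro null_sets_UN' assms)
  then show ?thesis by simp
qed

lemma borel_measurable_hausdorff1:
  fixes f :: "'a::metric_space \<Rightarrow> real"
  assumes "f \<in> borel_measurable borel"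
  shows "f \<in> borel_measurable hausdorff1"
proof (rule measurableI)
  fix A :: "real set" assume "A \<in> sets borel"
  then have "f -` A \<inter> space borel \<in> sets borel" by (rule measurable_sets[OF assms])
  then show "f -` A \<inter> space hausdorff1 \<in> sets hausdorff1" by (simp add: sets_hausdorff1_borel)
qed simp

context bounded_membrane
begin

text \<open>The sequence in the last claim is there for measurability. Its points may lie outside
  the domain for the first few \<open>k\<close>, and the default 0 extends \<open>u\<close>
  continuously.\<close>

lemma normal_derivative_limit:
  assumes x: "x \<in> frontier \<Omega>" and \<nu>: "outward_unit_normals \<Omega> x = {\<nu>}"
  shows "\<exists>D. has_normal_derivative \<Omega> u x D" "\<bar>normal_derivative \<Omega> u x\<bar> \<le> lip"
    "(\<lambda>k. - (real (Suc k) * (if x - (1 / real (Suc k)) *\<^sub>R \<nu> \<in> \<Omega> then u (x - (1 / real (Suc k)) *\<^sub>R \<nu>) else 0)))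
       \<longlonglongrightarrow> normal_derivative \<Omega> u x"
proof -
  define n where "n = - \<nu>"
  have "\<nu> \<in> outward_unit_normals \<Omega> x" using \<nu> by simp
  then have n: "norm n = 1" "\<And>y. y \<in> \<Omega> \<Longrightarrow> (y - x) \<bullet> n \<ge> 0"
    by (auto simp: n_def outward_unit_normals_def)
  have uniq: "v = n" if "norm v = 1" "\<And>y. y \<in> \<Omega> \<Longrightarrow> (y - x) \<bullet> v \<ge> 0" for v
  proof -
    have "- v \<in> outward_unit_normals \<Omega> x" using that by (simp add: outward_unit_normals_def)
    then show ?thesis using \<nu> by (auto simp: n_def)
  qed
  obtain t0 l where t0: "t0 > 0" "\<And>s. 0 < s \<Longrightarrow> s \<le> t0 \<Longrightarrow> x + s *\<^sub>R n \<in> \<Omega>"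
    and l: "((\<lambda>s. u (x + s *\<^sub>R n) / s) \<longlongrightarrow> l) (at_right 0)" "\<bar>l\<bar> \<le> lip"
    using tendsto_radial_quotient[OF x n uniq] by blast
  \<comment> \<open>Reflecting \<open>t\<close> turns the left derivative along the outward normal
    into minus the limit along the inward one, as \<open>u\<close> vanishes at
    \<open>x\<close>.\<close>
  have "((\<lambda>t. u (x + t *\<^sub>R \<nu>)) has_real_derivative - l) (at_left 0)"
    unfolding has_field_derivative_iff filterlim_at_left_to_right
    using tendsto_minus[OF l(1)] zero[OF x] by (simp add: n_def)
  then have D: "has_normal_derivative \<Omega> u x (- l)"
    using \<nu> unfolding has_normal_derivative_def by blast
  then show "\<exists>D. has_normal_derivative \<Omega> u x D" by blast
  have nd: "normal_derivative \<Omega> u x = - l" by (rule normal_derivative_eq[OF D])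
  then show "\<bar>normal_derivative \<Omega> u x\<bar> \<le> lip" using l by simp
  have lim: "filterlim (\<lambda>k. 1 / real (Suc k)) (at_right 0) sequentially"
    unfolding filterlim_at using LIMSEQ_inverse_real_of_nat by (simp add: inverse_eq_divide)
  have "\<forall>\<^sub>F s in at_right 0. - (u (x + s *\<^sub>R n) / s) = - (1 / s * (if x - s *\<^sub>R \<nu> \<in> \<Omega> then u (x - s *\<^sub>R \<nu>) else 0))"
    unfolding eventually_at_right_field using t0 by (intro exI[of _ t0]) (auto simp: n_def)
  with tendsto_minus[OF l(1)]
  have "((\<lambda>s. - (1 / s * (if x - s *\<^sub>R \<nu> \<in> \<Omega> then u (x - s *\<^sub>R \<nu>) else 0))) \<longlongrightarrow> - l) (at_right 0)"
    by (rule Lim_transform_eventually)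
  from filterlim_compose[OF this lim] show
    "(\<lambda>k. - (real (Suc k) * (if x - (1 / real (Suc k)) *\<^sub>R \<nu> \<in> \<Omega> then u (x - (1 / real (Suc k)) *\<^sub>R \<nu>) else 0)))
       \<longlonglongrightarrow> normal_derivative \<Omega> u x"
    unfolding nd by simp
qed

text \<open>\<open>Linfty_norm\<close> is infinite on functions that are not measurable, so most of
  the proof establishes measurability: at regular points the normal derivative is a pointwise limit
  of functions continuous there.\<close>

lemma normal_derivative_bound:
  "(AE x in boundary_measure \<Omega>. \<exists>D. has_normal_derivative \<Omega> u x D) \<and>
   Linfty_norm (boundary_measure \<Omega>) (normal_derivative \<Omega> u) \<le> ereal lip"
proof -
  define I where "I = {x \<in> frontier \<Omega>. \<nexists>\<nu>. outward_unit_normals \<Omega> x = {\<nu>}}"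
  define R where "R = frontier \<Omega> - I"
  define \<nu> where "\<nu> x = (THE \<nu>. outward_unit_normals \<Omega> x = {\<nu>})" for x
  let ?B = "boundary_measure \<Omega>"
  have I: "countable I"
    unfolding I_def by (rule countable_irregular_points[OF open_dom convex_dom nonempty])
  have \<nu>: "outward_unit_normals \<Omega> x = {\<nu> x}" if "x \<in> R" for x
    using that unfolding R_def I_def \<nu>_def by auto
  have fr: "frontier \<Omega> \<in> sets hausdorff1"
    by (rule closed_in_sets_hausdorff1) simp
  have AE_R: "AE x in ?B. x \<in> R"
    unfolding boundary_measure_def
    using AE_not_in[OF hausdorff1_countable_null[OF I]]
    by (subst AE_restrict_space_iff) (use fr in \<open>auto simp: R_def\<close>)
  \<comment> \<open>Extension by zero, continuous on the whole plane because \<open>u\<close>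
    vanishes on the boundary.\<close>
  define U where "U z = (if z \<in> \<Omega> then u z else 0)" for z
  have "continuous_on (closure \<Omega> \<union> - \<Omega>) U"
    unfolding U_def
  proof (rule continuous_on_cases)
    show "\<forall>z. z \<in> closure \<Omega> \<and> z \<notin> \<Omega> \<or> z \<in> - \<Omega> \<and> z \<in> \<Omega> \<longrightarrow> u z = 0"
      using in_dom by blast
  qed (use cont open_dom in auto)
  moreover have "closure \<Omega> \<union> - \<Omega> = UNIV" using closure_subset by blast
  ultimately have U: "continuous_on UNIV U" by simp
  define g where "g k x = (if x \<in> R then - (real (Suc k) * U (x - (1 / real (Suc k)) *\<^sub>R \<nu> x)) else 0)" for k x
  have R_borel: "R \<in> sets borel"
    unfolding R_def by (intro sets.Diff sets.countable[OF _ I] borel_closed) auto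
  have g: "g k \<in> borel_measurable borel" for k
    unfolding g_def
  proof (rule borel_measurable_continuous_on_if[OF R_borel])
    show "continuous_on R (\<lambda>x. - (real (Suc k) * U (x - (1 / real (Suc k)) *\<^sub>R \<nu> x)))"
      by (intro continuous_intros continuous_on_compose2[OF U] continuous_on_unit_normal[OF \<nu>]) auto
  qed simp
  define f where "f x = (if x \<in> R then normal_derivative \<Omega> u x else 0)" for x
  have "(\<lambda>k. g k x) \<longlonglongrightarrow> f x" for x
  proof (cases "x \<in> R")
    case True
    then have "x \<in> frontier \<Omega>" by (simp add: R_def)
    from normal_derivative_limit(3)[OF this \<nu>[OF True]] show ?thesis
      by (simp only: g_def f_def U_def True if_True)
  qed (simp add: g_def f_def)
  then have "f \<in> borel_measurable borel"
    by (intro borel_measurable_LIMSEQ_real[OF _ g])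
  then have "f \<in> borel_measurable ?B"
    unfolding boundary_measure_def
    by (intro measurable_restrict_space1 borel_measurable_hausdorff1)
  \<comment> \<open>At irregular points \<open>normal_derivative\<close> is an unspecified value,
    but they are countably many and each singleton is measurable, so measurability carries over from
    \<open>f\<close>.\<close>
  then have meas: "normal_derivative \<Omega> u \<in> borel_measurable ?B"
  proof (rule measurable_discrete_difference[OF _ I])
    fix x assume "x \<in> I"
    then have "x \<in> frontier \<Omega>" by (simp add: I_def)
    moreover have "{x} \<in> sets hausdorff1" by (rule closed_in_sets_hausdorff1) simp
    ultimately show "{x} \<in> sets ?B"
      unfolding boundary_measure_def by (simp add: sets_restrict_space_iff fr)
  qed (auto simp: f_def R_def boundary_measure_def space_restrict_space)
  have "AE x in ?B. \<exists>D. has_normal_derivative \<Omega> u x D"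
    using AE_R by eventually_elim (use normal_derivative_limit(1) \<nu> R_def in blast)
  moreover have "AE x in ?B. ereal \<bar>normal_derivative \<Omega> u x\<bar> \<le> ereal lip"
    using AE_R by eventually_elim (use normal_derivative_limit(2) \<nu> R_def in simp)
  then have "Linfty_norm ?B (normal_derivative \<Omega> u) \<le> ereal lip"
    unfolding Linfty_norm_def by (intro esssup_I) (use meas in measurable)
  ultimately show ?thesis by blast
qed

end

theorem theorem2:
  "\<exists>C::real. C > 0 \<and>
     (\<forall>(\<Omega> :: (real ^ 2) set) (lam :: real) (u :: real ^ 2 \<Rightarrow> real).
        open \<Omega> \<longrightarrow> connected \<Omega> \<longrightarrow> \<Omega> \<noteq> {} \<longrightarrow> bounded \<Omega> \<longrightarrow> convex \<Omega> \<longrightarrow>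
        first_dirichlet_eigenvalue \<Omega> lam \<longrightarrow>
        dirichlet_eigenpair \<Omega> lam u \<longrightarrow> L2_normalized \<Omega> u \<longrightarrow>
          (AE x in boundary_measure \<Omega>. \<exists>D. has_normal_derivative \<Omega> u x D) \<and>
          Linfty_norm (boundary_measure \<Omega>) (normal_derivative \<Omega> u) \<le> ereal (C * lam))"
\<comment> \<open>The constant is that of \<open>lip_le\<close>, applied with \<open>M\<close> the
  maximum of the absolute value of \<open>u\<close>, attained at \<open>x0\<close>.\<close>
proof (intro exI[of _ 64] conjI allI impI)
  fix \<Omega> :: "(real ^ 2) set" and lam :: real and u :: "real ^ 2 \<Rightarrow> real"
  assume \<Omega>: "open \<Omega>" "\<Omega> \<noteq> {}" "bounded \<Omega>" "convex \<Omega>"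
    and eig: "dirichlet_eigenpair \<Omega> lam u" and L2: "L2_normalized \<Omega> u"
  interpret membrane \<Omega> lam u
  proof
    fix x n :: "real ^ 2" assume x: "x \<in> \<Omega>" and n: "norm n = 1"
    have "C2_on \<Omega> u" "laplacian u x = - lam * u x"
      using eig x by (auto simp: dirichlet_eigenpair_def)
    then show "\<exists>a b. second_deriv0 (\<lambda>t. u (x + t *\<^sub>R n)) a \<and>
      second_deriv0 (\<lambda>t. u (x + t *\<^sub>R perp n)) b \<and> a + b = - lam * u x"
      using second_deriv0_laplacian[OF \<Omega>(1) _ x n] by metis
  qed (use \<Omega> eig in \<open>auto simp: dirichlet_eigenpair_def\<close>)
  obtain p where p: "p \<in> \<Omega>" "u p \<noteq> 0" using eig by (auto simp: dirichlet_eigenpair_def)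
  obtain x0 where x0: "x0 \<in> closure \<Omega>" "\<And>z. z \<in> closure \<Omega> \<Longrightarrow> \<bar>u z\<bar> \<le> \<bar>u x0\<bar>"
    using continuous_attains_sup[OF compact_closure_dom _ continuous_on_rabs[OF cont]] \<Omega>(2)
    by (metis closure_eq_empty)
  have "\<bar>u p\<bar> \<le> \<bar>u x0\<bar>" using x0(2) p(1) closure_subset by blast
  with p(2) have "\<bar>u x0\<bar> > 0" by linarith
  then interpret bounded_membrane \<Omega> lam u "\<bar>u x0\<bar>"
    by unfold_locales (use lam_pos[OF p] x0 in auto)
  note bound = normal_derivative_bound
  show "AE x in boundary_measure \<Omega>. \<exists>D. has_normal_derivative \<Omega> u x D" using bound by blast
  have "ereal lip \<le> ereal (64 * lam)" using lip_le[OF x0(1) refl L2] by simp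
  with bound show "Linfty_norm (boundary_measure \<Omega>) (normal_derivative \<Omega> u) \<le> ereal (64 * lam)"
    using order_trans by blast
qed simp

end
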